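(* A (finite, simple, undirected) graph $G=(V,E)$ is hereditarily ergodic if and only if $G$ is switchable.
   Context: A perfect matching of a graph $G=(V,E)$ is a set of pairwise disjoint edges covering every vertex; the empty graph has the unique perfect matching $\emptyset$. The transition graph $\mathcal{G}(G)$ of the switch chain has one vertex for each perfect matching of $G$; two perfect matchings $M,M'$ are adjacent iff they differ by a single switch, i.e. there are edges $uv,u'v'\in M$ such that $u'v,uv'\in E$ and $M'=(M\setminus\{uv,u'v'\})\cup\{u'v,uv'\}$. $G$ is ergodic if $\mathcal{G}(G)$ is connected (a graph with no vertices counts as connected). $G$ is hereditarily ergodic if the induced subgraph $G[U]$ is ergodic for every $U\subseteq V$. Let $C$ be an even cycle (not necessarily induced) of length $2r$ in $G$ with vertices numbered consecutively $v_1,v_2,\ldots,v_{2r}$ around $C$. A chord of $C$ is an edge $v_iv_j$ of $G$ joining two vertices of $C$ that is not an edge of $C$; it is odd if $j-i$ is odd and even if $j-i$ is even. An even switch of $C$ is given (for some choice of consecutive numbering of the vertices of $C$, with any starting vertex and direction) by indices $1\le i<j\le r$ such that $v_{2i-1}v_{2j-1}\in E$ and $v_{2i}v_{2j}\in E$; that is, a 4-cycle formed by the two cycle edges $v_{2i-1}v_{2i}$, $v_{2j-1}v_{2j}$ and the two even chords $v_{2i-1}v_{2j-1}$, $v_{2i}v_{2j}$. Deleting the edges $v_{2i-1}v_{2i}$, $v_{2j-1}v_{2j}$ divides $C$ into two vertex-disjoint paths $P_1$ (from $v_{2i}$ to $v_{2j-1}$) and $P_2$ (from $v_{2j}$ through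 $v_{2r},v_1$ to $v_{2i-1}$), endpoints included. A crossing chord of this even switch is a chord $v_kv_l$ of $C$, other than the two chords $v_{2i-1}v_{2j-1}$, $v_{2i}v_{2j}$ of the switch itself, with $v_k\in P_1$ and $v_l\in P_2$. $G$ is switchable if every even cycle of length at least 6 in $G$ has an odd chord, or has an even switch with a crossing chord. *)

theory Defs
  imports Main
begin

text \<open>A graph is a vertex set \<open>V\<close> together with a set \<open>E\<close> of two-element subsets of \<open>V\<close>.\<close>

locale finite_simple_graph =
  fixes V :: "'a set" and E :: "'a set set"
  assumes finite_verts: "finite V"
    and edge_wf: "\<And>e. e \<in> E \<Longrightarrow> e \<subseteq> V \<and> card e = 2"

definition connected_graph :: "'a set \<Rightarrow> 'a set set \<Rightarrow> bool" where
  "connected_graph V E \<longleftrightarrow>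
     (\<forall>x\<in>V. \<forall>y\<in>V. (\<lambda>a b. a \<in> V \<and> b \<in> V \<and> {a, b} \<in> E)\<^sup>*\<^sup>* x y)"

definition induced_edges :: "'a set set \<Rightarrow> 'a set \<Rightarrow> 'a set set" where
  "induced_edges E U = {e \<in> E. e \<subseteq> U}"


definition perfect_matching :: "'a set \<Rightarrow> 'a set set \<Rightarrow> 'a set set \<Rightarrow> bool" where
  "perfect_matching V E M \<longleftrightarrow> M \<subseteq> E \<and> pairwise disjnt M \<and> \<Union>M = V"

definition is_switch :: "'a set set \<Rightarrow> 'a set set \<Rightarrow> 'a set set \<Rightarrow> bool" where
  "is_switch E M M' \<longleftrightarrow>
     (\<exists>u v u' v'. {u, v} \<in> M \<and> {u', v'} \<in> M \<and> {u, v} \<noteq> {u', v'} \<and>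
        {u', v} \<in> E \<and> {u, v'} \<in> E \<and>
        M' = (M - {{u, v}, {u', v'}}) \<union> {{u', v}, {u, v'}})"

definition transition_verts :: "'a set \<Rightarrow> 'a set set \<Rightarrow> 'a set set set" where
  "transition_verts V E = {M. perfect_matching V E M}"

definition transition_edges :: "'a set \<Rightarrow> 'a set set \<Rightarrow> 'a set set set set" where
  "transition_edges V E =
     {{M, M'} | M M'. perfect_matching V E M \<and> perfect_matching V E M' \<and> is_switch E M M'}"

definition ergodic :: "'a set \<Rightarrow> 'a set set \<Rightarrow> bool" where
  "ergodic V E \<longleftrightarrow> connected_graph (transition_verts V E) (transition_edges V E)"

definition hereditarily_ergodic :: "'a set \<Rightarrow> 'a set set \<Rightarrow> bool" where
  "hereditarily_ergodic V E \<longleftrightarrow> (\<forall>U\<subseteq>V. ergodic U (induced_edges E U))"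


text \<open>A cycle is represented by its edge set \<open>C\<close>. A numbering of \<open>C\<close> is a sequence
  \<open>v 1, \<dots>, v n\<close> listing its vertices consecutively, with any starting vertex and direction; values
  of \<open>v\<close> outside \<open>{1..n}\<close> are irrelevant.\<close>

definition cycle_numbering :: "'a set set \<Rightarrow> nat \<Rightarrow> (nat \<Rightarrow> 'a) \<Rightarrow> bool" where
  "cycle_numbering C n v \<longleftrightarrow>
     3 \<le> n \<and> inj_on v {1..n} \<and>
     C = insert {v n, v 1} ((\<lambda>k. {v k, v (k + 1)}) ` {1..<n})"

definition is_cycle :: "'a set set \<Rightarrow> 'a set set \<Rightarrow> nat \<Rightarrow> bool" where
  "is_cycle E C n \<longleftrightarrow> C \<subseteq> E \<and> (\<exists>v. cycle_numbering C n v)"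

definition chord :: "'a set set \<Rightarrow> 'a set set \<Rightarrow> 'a set \<Rightarrow> bool" where
  "chord E C e \<longleftrightarrow> e \<in> E \<and> e \<subseteq> \<Union>C \<and> e \<notin> C"

text \<open>On an even cycle the parity of \<open>j - i\<close> does not depend on the numbering.\<close>

definition has_odd_chord :: "'a set set \<Rightarrow> 'a set set \<Rightarrow> nat \<Rightarrow> bool" where
  "has_odd_chord E C r \<longleftrightarrow>
     (\<exists>v i j. cycle_numbering C (2 * r) v \<and> 1 \<le> i \<and> i < j \<and> j \<le> 2 * r \<and>
        odd (j - i) \<and> chord E C {v i, v j})"

definition even_switch ::
  "'a set set \<Rightarrow> 'a set set \<Rightarrow> nat \<Rightarrow> (nat \<Rightarrow> 'a) \<Rightarrow> nat \<Rightarrow> nat \<Rightarrow> bool" where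
  "even_switch E C r v i j \<longleftrightarrow>
     cycle_numbering C (2 * r) v \<and> 1 \<le> i \<and> i < j \<and> j \<le> r \<and>
     {v (2 * i - 1), v (2 * j - 1)} \<in> E \<and> {v (2 * i), v (2 * j)} \<in> E"

text \<open>The index sets are those of the two paths left after deleting
  \<open>{v (2 * i - 1), v (2 * i)}\<close> and \<open>{v (2 * j - 1), v (2 * j)}\<close> from the cycle.\<close>

definition crossing_chord ::
  "'a set set \<Rightarrow> 'a set set \<Rightarrow> nat \<Rightarrow> (nat \<Rightarrow> 'a) \<Rightarrow> nat \<Rightarrow> nat \<Rightarrow> 'a set \<Rightarrow> bool" where
  "crossing_chord E C r v i j e \<longleftrightarrow>
     chord E C e \<and>
     e \<notin> {{v (2 * i - 1), v (2 * j - 1)}, {v (2 * i), v (2 * j)}} \<and>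
     (\<exists>k \<in> {2 * i..2 * j - 1}. \<exists>l \<in> {2 * j..2 * r} \<union> {1..2 * i - 1}. e = {v k, v l})"

definition switchable :: "'a set set \<Rightarrow> bool" where
  "switchable E \<longleftrightarrow>
     (\<forall>C r. 6 \<le> 2 * r \<and> is_cycle E C (2 * r) \<longrightarrow>
        has_odd_chord E C r \<or>
        (\<exists>v i j e. even_switch E C r v i j \<and> crossing_chord E C r v i j e))"

end

theory Submission
  imports Defs
begin

text \<open>Switchable graphs: by induction on \<open>card (M - M')\<close>, follow a cycle alternating between \<open>M\<close> and
  \<open>M'\<close>. A cycle of length 4 is a switch. An odd chord cuts the cycle into two shorter alternating
  cycles, which are treated one after the other. Otherwise perform the even switch; reversing one of
  its two paths gives an alternating cycle of the same length on which the crossing chord is odd.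

  Ergodic graphs: let \<open>C\<close> be a cycle without odd chord and without crossed even switch, and consider
  the graph induced by its vertices. The even switches on the first perfect matching of \<open>C\<close> do not
  interfere with each other, so every matching reachable from it arises by performing some
  of them independently. None of these contains an edge of the second matching of \<open>C\<close>.\<close>

section \<open>Cycles as periodic sequences\<close>

text \<open>An even switch need not bring \<open>M\<close> closer to \<open>M'\<close>, so the
  induction cannot continue from it directly. It helps because it makes the crossing chord odd, and
  an odd chord always yields a matching strictly closer to both ends. In the converse,
  non-interference is a cut argument. The vertices of one path of an uncrossed even switch form a
  set \<open>S\<close> such that every edge leaving \<open>S\<close> has both ends among the four
  vertices of the switch. An edge created by the switch has its ends on opposite sides of
  \<open>S\<close>, while a matching edge away from these four vertices lies on one side. Switching
  these two edges would therefore require an edge that leaves \<open>S\<close> elsewhere. So a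
  created edge can only be switched with its mirror image, which undoes the first switch. Absence of
  odd chords enters separately: with length at least 6, it forces every switch of two initial edges
  to be an even one.\<close>

text \<open>Indexing by all integers makes rotations of a numbering plain index shifts.\<close>

definition cyc :: "int \<Rightarrow> (int \<Rightarrow> 'a) \<Rightarrow> bool" where
  "cyc n x \<longleftrightarrow> (\<forall>k l. x k = x l \<longleftrightarrow> n dvd k - l)"

definition cedges :: "(int \<Rightarrow> 'a) \<Rightarrow> 'a set set" where
  "cedges x = range (\<lambda>k. {x k, x (k + 1)})"

lemma cyc_iff: "cyc n x \<Longrightarrow> x k = x l \<longleftrightarrow> n dvd k - l"
  by (simp add: cyc_def)

lemma small_dvd_int:
  fixes d :: int
  assumes "n dvd d" "\<bar>d\<bar> < n"
  shows "d = 0"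
  using assms dvd_imp_le_int[of d n] by linarith

lemma cyc_eqD: "cyc n x \<Longrightarrow> x k = x l \<Longrightarrow> \<bar>k - l\<bar> < n \<Longrightarrow> k = l"
  using small_dvd_int[of n "k - l"] cyc_iff[of n x k l] by simp

lemma cyc_rep:
  assumes "cyc n x" "0 < n"
  obtains l where "c \<le> l" "l < c + n" "x k = x l"
proof
  show "c \<le> c + (k - c) mod n" "c + (k - c) mod n < c + n" using assms by auto
  have "n dvd (k - c) - (k - c) mod n" by simp
  moreover have "k - (c + (k - c) mod n) = (k - c) - (k - c) mod n" by simp
  ultimately show "x k = x (c + (k - c) mod n)" using cyc_iff[OF assms(1)] by presburger
qed

lemma cyc_shift: "cyc n x \<Longrightarrow> cyc n (\<lambda>k. x (k + c))"
  by (simp add: cyc_def)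

lemma cedges_shift: "cedges (\<lambda>k. x (k + c)) = cedges x"
proof -
  have "{x k, x (k + 1)} = {x ((k - c) + c), x ((k - c) + 1 + c)}" for k
    by (simp add: algebra_simps)
  moreover have "{x (k + c), x (k + 1 + c)} = {x (k + c), x ((k + c) + 1)}" for k
    by (simp add: algebra_simps)
  ultimately show ?thesis unfolding cedges_def by blast
qed

lemma Union_cedges: "\<Union>(cedges x) = range x"
  unfolding cedges_def by blast

lemma cedges_iff:
  assumes "cyc n x"
  shows "{x k, x l} \<in> cedges x \<longleftrightarrow> n dvd l - k - 1 \<or> n dvd l - k + 1"
proof
  assume "{x k, x l} \<in> cedges x"
  then obtain m where "{x k, x l} = {x m, x (m + 1)}" by (auto simp: cedges_def)
  then consider "n dvd k - m" "n dvd l - (m + 1)" | "n dvd k - (m + 1)" "n dvd l - m"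
    using cyc_iff[OF assms] by (metis doubleton_eq_iff)
  then show "n dvd l - k - 1 \<or> n dvd l - k + 1"
  proof cases
    case 1
    have "l - k - 1 = (l - (m + 1)) - (k - m)" by simp
    then show ?thesis using 1 by (metis dvd_diff)
  next
    case 2
    have "l - k + 1 = (l - m) - (k - (m + 1))" by simp
    then show ?thesis using 2 by (metis dvd_diff)
  qed
next
  assume "n dvd l - k - 1 \<or> n dvd l - k + 1"
  then show "{x k, x l} \<in> cedges x"
  proof
    assume "n dvd l - k - 1"
    then have "x l = x (k + 1)" using cyc_iff[OF assms, of l "k + 1"] by (simp add: algebra_simps)
    then show ?thesis by (auto simp: cedges_def)
  next
    assume "n dvd l - k + 1"
    then have "x (l + 1) = x k" using cyc_iff[OF assms, of "l + 1" k] by (simp add: algebra_simps)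
    then have "{x k, x l} = {x l, x (l + 1)}" by auto
    then show ?thesis by (auto simp: cedges_def)
  qed
qed

text \<open>The free offset \<open>c\<close> allows a numbering to start at any prescribed vertex,
  for instance at the end of a given chord or switch.\<close>

lemma cycle_numbering_cedges:
  assumes "cyc (int n) x" "3 \<le> n"
  shows "cycle_numbering (cedges x) n (\<lambda>m. x (c + int m))"
  unfolding cycle_numbering_def
proof (intro conjI)
  show "3 \<le> n" by fact
  show "inj_on (\<lambda>m. x (c + int m)) {1..n}"
    by (rule inj_onI, drule cyc_eqD[OF assms(1)]) auto
  have wrap: "x (c + int n + k) = x (c + k)" for k
    using cyc_iff[OF assms(1), of "c + int n + k" "c + k"] by simp
  show "cedges x = insert {x (c + int n), x (c + int 1)}
          ((\<lambda>k. {x (c + int k), x (c + int (k + 1))}) ` {1..<n})" (is "_ = ?R")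
  proof
    show "?R \<subseteq> cedges x"
    proof -
      have "x (c + int 1) = x (c + int n + 1)" using wrap[of 1] by simp
      then have "{x (c + int n), x (c + int 1)} \<in> cedges x"
        by (auto simp: cedges_def)
      moreover have "{x (c + int k), x (c + int (k + 1))} \<in> cedges x" for k
        unfolding cedges_def by (rule range_eqI[of _ _ "c + int k"]) (simp add: algebra_simps)
      ultimately show ?thesis by blast
    qed
    show "cedges x \<subseteq> ?R"
    proof
      fix e assume "e \<in> cedges x"
      then obtain k where e: "e = {x k, x (k + 1)}" by (auto simp: cedges_def)
      obtain l where l: "c + 1 \<le> l" "l < c + 1 + int n" "x k = x l"
        using cyc_rep[OF assms(1), of "c + 1" k] assms(2) by auto
      have "x (k + 1) = x (l + 1)"
        using l(3) cyc_iff[OF assms(1)] by simp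
      then have e: "e = {x l, x (l + 1)}" using e l by simp
      define m where "m = nat (l - c)"
      have m: "l = c + int m" "1 \<le> m" "m \<le> n" using l by (auto simp: m_def)
      show "e \<in> ?R"
      proof (cases "m = n")
        case True
        then show ?thesis using e m wrap[of 1] by simp
      next
        case False
        then have "m \<in> {1..<n}" using m by simp
        moreover have "e = {x (c + int m), x (c + int (m + 1))}" using e m by (simp add: algebra_simps)
        ultimately show ?thesis by blast
      qed
    qed
  qed
qed

lemma cycle_numberingE:
  assumes "cycle_numbering C n v"
  obtains x where "cyc (int n) x" "C = cedges x" "\<And>m. 1 \<le> m \<Longrightarrow> m \<le> n \<Longrightarrow> v m = x (int m)"
proof
  \<comment> \<open>Numberings start at 1, so residues are taken of \<open>k - 1\<close> and shifted
    back; index 0 then stands for \<open>v n\<close>.\<close>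
  define x where "x k = v (nat ((k - 1) mod int n) + 1)" for k
  have n: "3 \<le> n" and inj: "inj_on v {1..n}"
    and C: "C = insert {v n, v 1} ((\<lambda>k. {v k, v (k + 1)}) ` {1..<n})"
    using assms by (auto simp: cycle_numbering_def)
  show cx: "cyc (int n) x"
    unfolding cyc_def
  proof (intro allI)
    fix k l
    have r: "nat ((j - 1) mod int n) + 1 \<in> {1..n}" for j
      using n by (simp add: Suc_le_eq nat_less_iff)
    have "x k = x l \<longleftrightarrow> nat ((k - 1) mod int n) + 1 = nat ((l - 1) mod int n) + 1"
      unfolding x_def using inj_on_eq_iff[OF inj r r] .
    also have "\<dots> \<longleftrightarrow> (k - 1) mod int n = (l - 1) mod int n"
      using n by (simp add: nat_eq_iff)
    also have "\<dots> \<longleftrightarrow> int n dvd k - l"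
      by (simp add: mod_eq_dvd_iff)
    finally show "x k = x l \<longleftrightarrow> int n dvd k - l" .
  qed
  show v: "v m = x (int m)" if "1 \<le> m" "m \<le> n" for m
  proof -
    have "(int m - 1) mod int n = int m - 1" using that by (intro mod_pos_pos_trivial) auto
    then show ?thesis using that by (simp add: x_def nat_diff_distrib)
  qed
  have "cycle_numbering (cedges x) n (\<lambda>m. x (0 + int m))"
    by (rule cycle_numbering_cedges[OF cx n])
  then have "cedges x = insert {x (int n), x 1} ((\<lambda>k. {x (int k), x (int (k + 1))}) ` {1..<n})"
    by (simp add: cycle_numbering_def)
  also have "\<dots> = insert {v n, v 1} ((\<lambda>k. {v k, v (k + 1)}) ` {1..<n})"
    using v n by (auto simp: image_iff)
  finally show "C = cedges x" using C by simp
qed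

section \<open>Perfect matchings and alternating cycles\<close>

text \<open>Transition edges are unordered pairs, so a switch in either direction counts; this makes
  reachability symmetric by definition.\<close>

definition sw_step :: "'a set \<Rightarrow> 'a set set \<Rightarrow> 'a set set \<Rightarrow> 'a set set \<Rightarrow> bool" where
  "sw_step U E M M' \<longleftrightarrow> perfect_matching U E M \<and> perfect_matching U E M' \<and>
     (is_switch E M M' \<or> is_switch E M' M)"

text \<open>Half of the length is the parameter. The value \<open>r = 1\<close> describes an edge
  common to \<open>M\<close> and \<open>M'\<close>, whence the assumption \<open>2 \<le> r\<close>
  in several lemmas.\<close>

definition altcyc :: "'a set set \<Rightarrow> 'a set set \<Rightarrow> int \<Rightarrow> (int \<Rightarrow> 'a) \<Rightarrow> bool" where
  "altcyc M M' r x \<longleftrightarrow> cyc (2 * r) x \<and>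
     (\<forall>k. {x (2 * k), x (2 * k + 1)} \<in> M \<and> {x (2 * k + 1), x (2 * k + 2)} \<in> M')"

lemma sw_step_sym: "sw_step U E M M' \<Longrightarrow> sw_step U E M' M"
  by (auto simp: sw_step_def)

lemma reach_sym: "(sw_step U E)\<^sup>*\<^sup>* M M' \<Longrightarrow> (sw_step U E)\<^sup>*\<^sup>* M' M"
  by (induction rule: rtranclp_induct) (auto intro: converse_rtranclp_into_rtranclp sw_step_sym)

lemma perfect_matching_eqD:
  "perfect_matching U E M \<Longrightarrow> e \<in> M \<Longrightarrow> e' \<in> M \<Longrightarrow> z \<in> e \<Longrightarrow> z \<in> e' \<Longrightarrow> e = e'"
  by (auto simp: perfect_matching_def pairwise_def disjnt_iff)

lemma perfect_matching_partner_unique: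
  assumes "perfect_matching U E M" "{u, w} \<in> M" "{u, w'} \<in> M"
  shows "w = w'"
  using perfect_matching_eqD[OF assms, of u] by (auto simp: doubleton_eq_iff)

text \<open>Edges of \<open>M - A\<close> avoid all vertices of \<open>A\<close>, and edges of
  \<open>B\<close> use only such vertices, so the two parts cannot meet. Both a single switch and an
  exchange along a whole cycle are instances.\<close>

lemma perfect_matching_replace:
  assumes M: "perfect_matching U E M" and A: "A \<subseteq> M" and B: "perfect_matching (\<Union>A) E B"
  shows "perfect_matching U E ((M - A) \<union> B)"
proof -
  have cross: "disjnt e f" if "e \<in> M - A" "f \<in> B" for e f
  proof -
    have "f \<subseteq> \<Union>A" using B that by (auto simp: perfect_matching_def)
    moreover have "disjnt e a" if "a \<in> A" for a
      using \<open>e \<in> M - A\<close> that A perfect_matching_eqD[OF M, of e a] by (auto simp: disjnt_iff)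
    ultimately show ?thesis by (auto simp: disjnt_iff)
  qed
  have "pairwise disjnt ((M - A) \<union> B)"
    using M B cross unfolding perfect_matching_def pairwise_def
    by (metis DiffD1 Un_iff disjnt_sym)
  moreover have "\<Union>((M - A) \<union> B) = U"
    using M A B by (auto simp: perfect_matching_def)
  ultimately show ?thesis
    using M B by (auto simp: perfect_matching_def)
qed

lemma altcyc_shift: "altcyc M M' r x \<Longrightarrow> altcyc M M' r (\<lambda>k. x (k + 2 * c))"
  unfolding altcyc_def
proof (elim conjE, intro conjI allI)
  fix k assume "cyc (2 * r) x"
    and *: "\<forall>k. {x (2 * k), x (2 * k + 1)} \<in> M \<and> {x (2 * k + 1), x (2 * k + 2)} \<in> M'"
  show "cyc (2 * r) (\<lambda>k. x (k + 2 * c))" by (rule cyc_shift) fact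
  show "{x (2 * k + 2 * c), x (2 * k + 1 + 2 * c)} \<in> M"
    "{x (2 * k + 1 + 2 * c), x (2 * k + 2 + 2 * c)} \<in> M'"
    using *[rule_format, of "k + c"] by (auto simp: algebra_simps)
qed

text \<open>Turning by one position exchanges the two matchings, so chords starting at odd positions
  reduce to those starting at even ones.\<close>

lemma altcyc_swap: "altcyc M M' r x \<Longrightarrow> altcyc M' M r (\<lambda>k. x (k + 1))"
  unfolding altcyc_def
proof (elim conjE, intro conjI allI)
  fix k assume "cyc (2 * r) x"
    and *: "\<forall>k. {x (2 * k), x (2 * k + 1)} \<in> M \<and> {x (2 * k + 1), x (2 * k + 2)} \<in> M'"
  show "cyc (2 * r) (\<lambda>k. x (k + 1))" by (rule cyc_shift) fact
  show "{x (2 * k + 1), x (2 * k + 1 + 1)} \<in> M'"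
    "{x (2 * k + 1 + 1), x (2 * k + 2 + 1)} \<in> M"
    using *[rule_format, of k] *[rule_format, of "k + 1"] by (auto simp: algebra_simps)
qed

text \<open>Since neither property holds twice in a row and one of them always holds, the value at 0
  determines all others in both directions.\<close>

lemma alternating_parity:
  fixes P Q :: "int \<Rightarrow> bool"
  assumes "\<And>k. P k \<or> Q k" "\<And>k. \<not> (P k \<and> P (k + 1))" "\<And>k. \<not> (Q k \<and> Q (k + 1))" "P 0"
  shows "P (2 * k) \<and> Q (2 * k + 1)"
proof (induction k rule: int_induct[where k = 0])
  case base
  then show ?case using assms(1)[of 1] assms(2)[of 0] assms(4) by simp
next
  case (step1 i)
  then show ?case
    using assms(1)[of "2 * i + 2"] assms(3)[of "2 * i + 1"] assms(1)[of "2 * i + 3"] assms(2)[of "2 * i + 2"]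
    by (simp add: algebra_simps)
next
  case (step2 i)
  then show ?case
    using assms(1)[of "2 * i - 1"] assms(2)[of "2 * i - 1"] assms(1)[of "2 * i - 2"] assms(3)[of "2 * i - 2"]
    by (simp add: algebra_simps)
qed

lemma altcyc_cedges_subset:
  assumes alt: "altcyc M M' r x"
  shows "cedges x \<subseteq> M \<union> M'"
proof
  fix e assume "e \<in> cedges x"
  then obtain k where k: "e = {x k, x (k + 1)}" by (auto simp: cedges_def)
  have "k = 2 * (k div 2) \<or> k = 2 * (k div 2) + 1" by presburger
  then show "e \<in> M \<union> M'"
  proof
    assume "k = 2 * (k div 2)"
    then have "e = {x (2 * (k div 2)), x (2 * (k div 2) + 1)}" using k by simp
    then show ?thesis using alt by (simp add: altcyc_def)
  next
    assume *: "k = 2 * (k div 2) + 1"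
    then have "k + 1 = 2 * (k div 2) + 2" by simp
    then have "e = {x (2 * (k div 2) + 1), x (2 * (k div 2) + 2)}" using k * by metis
    then show ?thesis using alt by (simp add: altcyc_def)
  qed
qed

text \<open>Chords and switches come with their own numbering of the cycle. Consecutive edges share
  a vertex, so they lie in different matchings under any numbering; only the owner of the edge at
  position 0 is undetermined.\<close>

lemma altcyc_renumber:
  assumes M: "perfect_matching U E M" and M': "perfect_matching U E M'"
    and alt: "altcyc M M' r x" and r: "2 \<le> r"
    and y: "cyc (2 * r) y" "cedges y = cedges x"
  shows "altcyc M M' r y \<or> altcyc M' M r y"
proof -
  define P Q where "P k \<longleftrightarrow> {y k, y (k + 1)} \<in> M" and "Q k \<longleftrightarrow> {y k, y (k + 1)} \<in> M'" for k
  have "cedges x \<subseteq> M \<union> M'" using altcyc_cedges_subset[OF alt] .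
  moreover have "{y k, y (k + 1)} \<in> cedges y" for k by (simp add: cedges_def)
  ultimately have or: "P k \<or> Q k" for k
    using y(2) unfolding P_def Q_def by auto
  have no2: "y k \<noteq> y (k + 1 + 1)" for k
    using cyc_eqD[OF y(1), of k "k + 1 + 1"] r by auto
  have ninP: "\<not> (P k \<and> P (k + 1))" for k
    using perfect_matching_partner_unique[OF M, of "y (k + 1)" "y k" "y (k + 1 + 1)"] no2
    by (auto simp: P_def insert_commute)
  have ninQ: "\<not> (Q k \<and> Q (k + 1))" for k
    using perfect_matching_partner_unique[OF M', of "y (k + 1)" "y k" "y (k + 1 + 1)"] no2
    by (auto simp: Q_def insert_commute)
  from or[of 0] show ?thesis
  proof
    assume "P 0"
    then have "altcyc M M' r y"
      using alternating_parity[of P Q, OF or ninP ninQ] y(1)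
      by (auto simp: altcyc_def P_def Q_def algebra_simps)
    then show ?thesis ..
  next
    assume "Q 0"
    then have "altcyc M' M r y"
      using alternating_parity[of Q P, OF or[unfolded disj_commute[of "P _"]] ninQ ninP] y(1)
      by (auto simp: altcyc_def P_def Q_def algebra_simps)
    then show ?thesis ..
  qed
qed

text \<open>Otherwise \<open>x (2 * k)\<close> would have both of its cycle neighbours as partners
  in \<open>M'\<close>, and these differ as soon as \<open>2 \<le> r\<close>.\<close>

lemma altcyc_new_edge:
  assumes "perfect_matching U E M'" "altcyc M M' r x" "2 \<le> r"
  shows "{x (2 * k), x (2 * k + 1)} \<notin> M'"
proof
  assume "{x (2 * k), x (2 * k + 1)} \<in> M'"
  moreover have "{x (2 * (k - 1) + 1), x (2 * (k - 1) + 2)} \<in> M'"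
    using assms(2) unfolding altcyc_def by blast
  then have "{x (2 * k), x (2 * k - 1)} \<in> M'"
    by (simp add: insert_commute algebra_simps)
  ultimately have "x (2 * k + 1) = x (2 * k - 1)"
    using perfect_matching_partner_unique[OF assms(1)] by blast
  then show False
    using cyc_eqD[of "2 * r" x "2 * k + 1" "2 * k - 1"] assms(2,3) by (auto simp: altcyc_def)
qed

context finite_simple_graph
begin

section \<open>Perfect matchings and switches in a simple graph\<close>

lemma edge_neq: "{u, w} \<in> E \<Longrightarrow> u \<noteq> w"
  using edge_wf[of "{u, w}"] by auto

lemma edgeE:
  assumes "e \<in> E"
  obtains u w where "e = {u, w}" "u \<noteq> w"
  using edge_wf[OF assms] by (auto simp: card_2_iff)

lemma perfect_matching_ex:
  assumes "perfect_matching U E M" "u \<in> U"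
  obtains w where "{u, w} \<in> M" "w \<in> U" "w \<noteq> u"
proof -
  obtain e where e: "e \<in> M" "u \<in> e" using assms by (auto simp: perfect_matching_def)
  moreover have "e \<in> E" using assms e by (auto simp: perfect_matching_def)
  then obtain a b where "e = {a, b}" "a \<noteq> b" by (rule edgeE)
  ultimately obtain w where "e = {u, w}" "w \<noteq> u" by auto
  moreover from this have "w \<in> U" using assms(1) e(1) by (auto simp: perfect_matching_def)
  ultimately show ?thesis using that e by blast
qed

lemma perfect_matching_card:
  assumes "perfect_matching U E M" "finite U"
  shows "finite M" "card U = 2 * card M"
proof -
  show "finite M" using assms finite_UnionD by (auto simp: perfect_matching_def)
  have *: "card e = 2" if "e \<in> M" for e using assms that edge_wf by (auto simp: perfect_matching_def)
  have "finite e" if "e \<in> M" for e using *[OF that] by (intro card_ge_0_finite) simp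
  then have "card U = sum card M"
    using assms card_Union_disjoint[of M] by (simp add: perfect_matching_def)
  also have "\<dots> = 2 * card M" using * by simp
  finally show "card U = 2 * card M" .
qed

lemma perfect_matching_diff_card:
  assumes "perfect_matching U E M" "perfect_matching U E M'" "finite U"
  shows "card (M - M') = card (M' - M)"
proof -
  have "card M = card M'" "finite M" "finite M'"
    using perfect_matching_card assms by (metis mult_cancel1 zero_neq_numeral)+
  then show ?thesis by (simp add: card_Diff_subset_Int Int_commute)
qed

lemma switch_perfect_matching:
  assumes M: "perfect_matching U E M"
    and e: "{u, v} \<in> M" "{u', v'} \<in> M" "{u, v} \<noteq> {u', v'}" "{u', v} \<in> E" "{u, v'} \<in> E"
  shows "perfect_matching U E ((M - {{u, v}, {u', v'}}) \<union> {{u', v}, {u, v'}})"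
proof (rule perfect_matching_replace[OF M])
  have d: "u \<noteq> v" "u' \<noteq> v'" using M e edge_neq by (auto simp: perfect_matching_def)
  have "u \<notin> {u', v'}" "v \<notin> {u', v'}"
    using perfect_matching_eqD[OF M e(1,2)] e(3) by auto
  then show "perfect_matching (\<Union>{{u, v}, {u', v'}}) E {{u', v}, {u, v'}}"
    using e d by (auto simp: perfect_matching_def pairwise_def disjnt_iff)
qed (use e in auto)

text \<open>The two new edges do not belong to \<open>M\<close>, so deleting them again restores
  \<open>M\<close> exactly. The reverse switch exchanges the roles of \<open>u\<close> and
  \<open>u'\<close>.\<close>

lemma is_switch_sym:
  assumes M: "perfect_matching U E M" and "is_switch E M M'"
  shows "is_switch E M' M"
proof -
  obtain u v u' v' where e: "{u, v} \<in> M" "{u', v'} \<in> M" "{u, v} \<noteq> {u', v'}" "{u', v} \<in> E" "{u, v'} \<in> E"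
    and M': "M' = (M - {{u, v}, {u', v'}}) \<union> {{u', v}, {u, v'}}"
    using assms(2) unfolding is_switch_def by blast
  have d: "u \<noteq> v" "u' \<noteq> v'" using M e edge_neq by (auto simp: perfect_matching_def)
  have d2: "u \<notin> {u', v'}" "v \<notin> {u', v'}"
    using perfect_matching_eqD[OF M e(1,2)] e(3) by auto
  have "{u', v} \<notin> M" "{u, v'} \<notin> M"
    using perfect_matching_eqD[OF M e(1), of "{u', v}" v] perfect_matching_eqD[OF M e(1), of "{u, v'}" u] d d2
    by (auto simp: doubleton_eq_iff)
  then have "M = (M' - {{u', v}, {u, v'}}) \<union> {{u, v}, {u', v'}}"
    unfolding M' using e(1,2) by auto
  moreover have "{u, v} \<in> E" "{u', v'} \<in> E" using M e by (auto simp: perfect_matching_def)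
  moreover have "{u', v} \<noteq> {u, v'}" using d d2 by (auto simp: doubleton_eq_iff)
  moreover have "{u', v} \<in> M'" "{u, v'} \<in> M'" unfolding M' by auto
  ultimately show ?thesis unfolding is_switch_def
    by (intro exI[of _ u'] exI[of _ v] exI[of _ u] exI[of _ v'] conjI)
qed

section \<open>Restriction to induced subgraphs\<close>

lemma perfect_matching_induced:
  "perfect_matching U (induced_edges E U) M \<longleftrightarrow> perfect_matching U E M"
  by (auto simp: perfect_matching_def induced_edges_def)

lemma is_switch_induced:
  assumes "perfect_matching U E M"
  shows "is_switch (induced_edges E U) M M' \<longleftrightarrow> is_switch E M M'"
proof -
  have "u \<in> U \<and> v \<in> U" if "{u, v} \<in> M" for u v using assms that by (auto simp: perfect_matching_def)
  then show ?thesis unfolding is_switch_def induced_edges_def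
    by (intro iff_exI conj_cong refl) auto
qed

lemma ergodic_induced_iff:
  "ergodic U (induced_edges E U) \<longleftrightarrow>
     (\<forall>M M'. perfect_matching U E M \<longrightarrow> perfect_matching U E M' \<longrightarrow> (sw_step U E)\<^sup>*\<^sup>* M M')"
proof -
  have "{a, b} \<in> transition_edges U (induced_edges E U) \<longleftrightarrow> sw_step U E a b" for a b
    unfolding transition_edges_def sw_step_def perfect_matching_induced mem_Collect_eq doubleton_eq_iff
    using is_switch_induced[of U a b] is_switch_induced[of U b a] by blast
  then have "(\<lambda>a b. a \<in> transition_verts U (induced_edges E U) \<and> b \<in> transition_verts U (induced_edges E U) \<and>
      {a, b} \<in> transition_edges U (induced_edges E U)) = sw_step U E"
    by (intro ext)
      (auto simp: transition_verts_def sw_step_def perfect_matching_induced)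
  then show ?thesis
    by (auto simp: ergodic_def connected_graph_def transition_verts_def perfect_matching_induced)
qed

section \<open>Switchable graphs are ergodic\<close>

text \<open>The chord closes the path \<open>x 0, ..., x (2 * t + 1)\<close> to an alternating
  cycle: its \<open>M\<close>-edges \<open>A\<close> are exchanged for \<open>B\<close>, the chord
  and the \<open>M'\<close>-edges of the path. The bounds on \<open>t\<close> exclude
  \<open>t = 0\<close> and \<open>t = r - 1\<close>, where the chord would be a cycle edge.\<close>

lemma odd_chord_intermediate_aux:
  assumes M: "perfect_matching U E M" and M': "perfect_matching U E M'" and fin: "finite U"
    and alt: "altcyc M M' r x" and t: "1 \<le> t" "t \<le> r - 2" and ch: "{x 0, x (2 * t + 1)} \<in> E"
  shows "\<exists>M''. perfect_matching U E M'' \<and> card (M - M'') < card (M - M') \<and>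
    card (M'' - M') < card (M - M')"
proof -
  have cx: "cyc (2 * r) x" and eM: "{x (2 * k), x (2 * k + 1)} \<in> M"
    and eM': "{x (2 * k + 1), x (2 * k + 2)} \<in> M'" for k
    using alt by (auto simp: altcyc_def)
  define A where "A = (\<lambda>k. {x (2 * k), x (2 * k + 1)}) ` {0..t}"
  define B where "B = insert {x 0, x (2 * t + 1)} ((\<lambda>k. {x (2 * k + 1), x (2 * k + 2)}) ` {0..<t})"
  define M'' where "M'' = (M - A) \<union> B"
  have finM: "finite M" using perfect_matching_card[OF M fin] by simp
  have AM: "A \<subseteq> M" using eM by (auto simp: A_def)
  have new: "{x (2 * k), x (2 * k + 1)} \<in> M - M'" for k
    using eM altcyc_new_edge[OF M' alt] t by auto
  have UA: "\<Union>A = x ` {0..2 * t + 1}"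
  proof
    show "\<Union>A \<subseteq> x ` {0..2 * t + 1}" by (auto simp: A_def)
    show "x ` {0..2 * t + 1} \<subseteq> \<Union>A"
    proof
      fix z assume "z \<in> x ` {0..2 * t + 1}"
      then obtain k where k: "z = x k" "0 \<le> k" "k \<le> 2 * t + 1" by auto
      then have "k div 2 \<in> {0..t}" by auto
      moreover have "k = 2 * (k div 2) \<or> k = 2 * (k div 2) + 1" by presburger
      then have "z \<in> {x (2 * (k div 2)), x (2 * (k div 2) + 1)}" using k by auto
      ultimately show "z \<in> \<Union>A" unfolding A_def by blast
    qed
  qed
  have UB: "\<Union>B = x ` {0..2 * t + 1}"
  proof
    show "\<Union>B \<subseteq> x ` {0..2 * t + 1}" using t by (auto simp: B_def)
    show "x ` {0..2 * t + 1} \<subseteq> \<Union>B"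
    proof
      fix z assume "z \<in> x ` {0..2 * t + 1}"
      then obtain k where k: "z = x k" "0 \<le> k" "k \<le> 2 * t + 1" by auto
      show "z \<in> \<Union>B"
      proof (cases "k = 0 \<or> k = 2 * t + 1")
        case True
        then show ?thesis using k by (auto simp: B_def)
      next
        case False
        define j where "j = (k - 1) div 2"
        have j: "j \<in> {0..<t}" using False k by (auto simp: j_def)
        have "k = 2 * j + 1 \<or> k = 2 * j + 2" unfolding j_def by presburger
        then have "z \<in> {x (2 * j + 1), x (2 * j + 2)}" using k by auto
        then show ?thesis using j unfolding B_def by blast
      qed
    qed
  qed
  have chd: "disjnt {x 0, x (2 * t + 1)} {x (2 * k + 1), x (2 * k + 2)}" if "k \<in> {0..<t}" for k
  proof -
    have "x i \<noteq> x j" if "i \<in> {0, 2 * t + 1}" "j \<in> {2 * k + 1, 2 * k + 2}" for i j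
      using cyc_eqD[OF cx, of i j] that \<open>k \<in> {0..<t}\<close> t by auto
    from this[of 0 "2 * k + 1"] this[of 0 "2 * k + 2"] this[of "2 * t + 1" "2 * k + 1"]
      this[of "2 * t + 1" "2 * k + 2"]
    show ?thesis by (simp add: disjnt_def)
  qed
  have "pairwise disjnt B"
  proof -
    have "pairwise disjnt M'" using M' by (simp add: perfect_matching_def)
    moreover have "(\<lambda>k. {x (2 * k + 1), x (2 * k + 2)}) ` {0..<t} \<subseteq> M'" using eM' by blast
    ultimately have "pairwise disjnt ((\<lambda>k. {x (2 * k + 1), x (2 * k + 2)}) ` {0..<t})"
      by (rule pairwise_subset)
    moreover have "disjnt {x 0, x (2 * t + 1)} f \<and> disjnt f {x 0, x (2 * t + 1)}"
      if "f \<in> (\<lambda>k. {x (2 * k + 1), x (2 * k + 2)}) ` {0..<t}" for f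
      using that chd disjnt_sym by blast
    ultimately show ?thesis
      unfolding B_def pairwise_insert by blast
  qed
  moreover have "B \<subseteq> E" using M' eM' ch by (auto simp: B_def perfect_matching_def)
  ultimately have "perfect_matching (\<Union>A) E B"
    by (simp add: perfect_matching_def UA UB)
  then have "perfect_matching U E M''"
    unfolding M''_def by (rule perfect_matching_replace[OF M AM])
  moreover have "card (M - M'') < card (M - M')"
  proof (rule psubset_card_mono)
    \<comment> \<open>Strictness: \<open>t + 1 \<le> r - 1\<close>, so this \<open>M\<close>-edge
      lies beyond the path and is kept by \<open>M''\<close>.\<close>
    have "x (2 * (t + 1)) \<notin> \<Union>A"
      unfolding UA using cyc_eqD[OF cx, of "2 * (t + 1)"] t by fastforce
    then have "{x (2 * (t + 1)), x (2 * (t + 1) + 1)} \<notin> A" by blast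
    then have "{x (2 * (t + 1)), x (2 * (t + 1) + 1)} \<notin> M - M''" by (auto simp: M''_def)
    moreover have "M - M'' \<subseteq> M - M'"
      using new by (auto simp: M''_def A_def)
    ultimately show "M - M'' \<subset> M - M'" using new[of "t + 1"] by blast
  qed (use finM in auto)
  moreover have "card (M'' - M') < card (M - M')"
  proof -
    \<comment> \<open>Because \<open>1 \<le> t\<close>, at least two edges of \<open>M - M'\<close>
      are given up, while the chord is the only edge outside \<open>M'\<close> that can
      enter.\<close>
    let ?e = "{x (2 * 0), x (2 * 0 + 1)}" and ?f = "{x (2 * 1), x (2 * 1 + 1)}"
    have A2: "?e \<in> A" "?f \<in> A" unfolding A_def using t by (intro imageI; simp)+
    have new: "?e \<in> M - M'" "?f \<in> M - M'" by (rule new)+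
    have ef: "?e \<noteq> ?f"
      using cyc_eqD[OF cx, of 0 2] cyc_eqD[OF cx, of 0 3] t by (auto simp: doubleton_eq_iff)
    have "M'' - M' \<subseteq> insert {x 0, x (2 * t + 1)} (M - M' - {?e, ?f})"
      using A2 eM' by (auto simp: M''_def B_def)
    then have "card (M'' - M') \<le> card (insert {x 0, x (2 * t + 1)} (M - M' - {?e, ?f}))"
      using finM by (intro card_mono) auto
    also have "\<dots> \<le> Suc (card (M - M' - {?e, ?f}))"
      using finM by (simp add: card_insert_if)
    also have "card (M - M' - {?e, ?f}) = card (M - M') - 2"
      using new ef by (subst card_Diff_subset) auto
    also have "2 \<le> card (M - M')"
      using card_mono[of "M - M'" "{?e, ?f}"] new ef finM by auto
    then have "Suc (card (M - M') - 2) < card (M - M')" by simp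
    finally show ?thesis .
  qed
  ultimately show ?thesis by blast
qed

text \<open>Rotation moves \<open>a\<close> to 0 and \<open>b\<close> to some \<open>l\<close> in
  the first period. The period is even, so \<open>l\<close> stays odd, and \<open>l = 1\<close> and
  \<open>l = 2 * r - 1\<close> are the neighbours of 0 on the cycle.\<close>

lemma odd_chord_intermediate_even:
  assumes M: "perfect_matching U E M" and M': "perfect_matching U E M'" and fin: "finite U"
    and alt: "altcyc M M' r x" and r: "2 \<le> r"
    and ch: "{x a, x b} \<in> E" "{x a, x b} \<notin> cedges x" and ab: "odd (b - a)" "even a"
  shows "\<exists>M''. perfect_matching U E M'' \<and> card (M - M'') < card (M - M') \<and>
    card (M'' - M') < card (M - M')"
proof -
  from ab obtain c where c: "a = 2 * c" by (auto elim: evenE)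
  define y where "y = (\<lambda>k. x (k + 2 * c))"
  have alt': "altcyc M M' r y" unfolding y_def by (rule altcyc_shift[OF alt])
  then have cy: "cyc (2 * r) y" by (simp add: altcyc_def)
  have ye: "cedges y = cedges x" unfolding y_def by (rule cedges_shift)
  have y0: "y 0 = x a" "y (b - a) = x b" using c by (auto simp: y_def)
  obtain l where l: "0 \<le> l" "l < 2 * r" "y (b - a) = y l"
    using cyc_rep[OF cy, of 0 "b - a"] r by auto
  have "2 * r dvd (b - a) - l" using l(3) cyc_iff[OF cy] by blast
  then have "even ((b - a) - l)" using dvd_mult_left by blast
  then have "odd l" using ab by simp
  then obtain t where t: "l = 2 * t + 1" by (auto elim: oddE)
  have "{y 0, y l} \<notin> cedges y" using ch y0 ye l by simp
  then have "\<not> 2 * r dvd l - 0 - 1" "\<not> 2 * r dvd l - 0 + 1"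
    using cedges_iff[OF cy] by blast+
  then have "l \<noteq> 1" "l \<noteq> 2 * r - 1" by auto
  then have "1 \<le> t" "t \<le> r - 2" using t l by auto
  moreover have "{y 0, y (2 * t + 1)} \<in> E" using ch y0 l t by simp
  ultimately show ?thesis using odd_chord_intermediate_aux[OF M M' fin alt'] by blast
qed

text \<open>An odd chord splits the cycle into two shorter alternating cycles, so one can pass from
  \<open>M\<close> to \<open>M'\<close> through a matching that is closer to both of them.\<close>

lemma odd_chord_intermediate:
  assumes M: "perfect_matching U E M" and M': "perfect_matching U E M'" and fin: "finite U"
    and alt: "altcyc M M' r x" and r: "2 \<le> r"
    and ch: "{x a, x b} \<in> E" "{x a, x b} \<notin> cedges x" and ab: "odd (b - a)"
  obtains M'' where "perfect_matching U E M''" "card (M - M'') < card (M - M')"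
    "card (M'' - M') < card (M - M')"
proof (cases "even a")
  case True
  then show ?thesis using odd_chord_intermediate_even[OF assms] that by blast
next
  case False
  have "{x (a - 1 + 1), x (b - 1 + 1)} \<notin> cedges (\<lambda>k. x (k + 1))"
    using ch(2) cedges_shift[of x 1] by simp
  then obtain M'' where *: "perfect_matching U E M''" "card (M' - M'') < card (M' - M)"
    "card (M'' - M) < card (M' - M)"
    using odd_chord_intermediate_even[OF M' M fin altcyc_swap[OF alt] r, of "a - 1" "b - 1"] ch ab False
    by auto
  \<comment> \<open>Exchanging \<open>M\<close> and \<open>M'\<close> also exchanges the two
    inequalities; equal sizes of the two differences of perfect matchings turn them back.\<close>
  show ?thesis
    by (rule that[OF *(1)])
      (use * perfect_matching_diff_card M M' fin in metis)+
qed

text \<open>The sequence \<open>y\<close> below traverses the path \<open>x 1, \<dots>, x (2 * d)\<close> backwards. This changes the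
  parity of the positions on that path relative to the rest of the cycle, so that an even crossing
  chord of \<open>x\<close> is an odd chord of \<open>y\<close>.\<close>

lemma even_switch_reverse:
  assumes M: "perfect_matching U E M" and M': "perfect_matching U E M'" and fin: "finite U"
    and alt: "altcyc M M' r x" and d: "0 < d" "d < r"
    and sw: "{x 0, x (2 * d)} \<in> E" "{x 1, x (2 * d + 1)} \<in> E"
    and ch: "{x p, x q} \<in> E" "{x p, x q} \<notin> cedges x"
      "{x p, x q} \<noteq> {x 0, x (2 * d)}" "{x p, x q} \<noteq> {x 1, x (2 * d + 1)}"
    and p: "1 \<le> p" "p \<le> 2 * d" and q: "2 * d + 1 \<le> q" "q \<le> 2 * r" and ev: "even (q - p)"
  obtains M1 y a b where "perfect_matching U E M1" "is_switch E M M1" "altcyc M1 M' r y"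
    "{y a, y b} \<in> E" "{y a, y b} \<notin> cedges y" "odd (b - a)" "card (M1 - M') \<le> card (M - M')"
proof -
  have cx: "cyc (2 * r) x" and eM: "{x (2 * k), x (2 * k + 1)} \<in> M"
    and eM': "{x (2 * k + 1), x (2 * k + 2)} \<in> M'" for k
    using alt by (auto simp: altcyc_def)
  have x2r: "x (2 * r) = x 0" using cyc_iff[OF cx, of "2 * r" 0] by simp
  have ne: "x i \<noteq> x j" if "i \<noteq> j" "0 \<le> i" "i < 2 * r" "0 \<le> j" "j < 2 * r" for i j
  proof -
    have "\<bar>i - j\<bar> < 2 * r" using that by linarith
    then show ?thesis using cyc_eqD[OF cx, of i j] that by blast
  qed
  define M1 where "M1 = (M - {{x 0, x 1}, {x (2 * d + 1), x (2 * d)}}) \<union>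
    {{x (2 * d + 1), x 1}, {x 0, x (2 * d)}}"
  have e01: "{x 0, x 1} \<in> M" using eM[of 0] by simp
  have e2d: "{x (2 * d + 1), x (2 * d)} \<in> M" using eM[of d] by (simp add: insert_commute)
  have diff: "{x 0, x 1} \<noteq> {x (2 * d + 1), x (2 * d)}"
    using ne[of 0 "2 * d"] ne[of 0 "2 * d + 1"] d by (auto simp: doubleton_eq_iff)
  have sw1: "{x (2 * d + 1), x 1} \<in> E" using sw by (simp add: insert_commute)
  have pm1: "perfect_matching U E M1"
    unfolding M1_def by (rule switch_perfect_matching[OF M e01 e2d diff sw1 sw(1)])
  have is1: "is_switch E M M1"
    unfolding is_switch_def M1_def using e01 e2d diff sw1 sw(1) by blast
  define s where "s l = (if 1 \<le> l \<and> l \<le> 2 * d then 2 * d + 1 - l else l)" for l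
  define y where "y k = x (s (k mod (2 * r)))" for k
  have cy: "cyc (2 * r) y"
    unfolding cyc_def
  proof (intro allI)
    fix k l
    have r: "0 \<le> s (j mod (2 * r)) \<and> s (j mod (2 * r)) < 2 * r" for j
      using pos_mod_bound[of "2 * r" j] pos_mod_sign[of "2 * r" j] d by (auto simp: s_def)
    have "y k = y l \<longleftrightarrow> s (k mod (2 * r)) = s (l mod (2 * r))"
      using ne r unfolding y_def by metis
    also have "\<dots> \<longleftrightarrow> k mod (2 * r) = l mod (2 * r)"
      by (auto simp: s_def split: if_splits)
    also have "\<dots> \<longleftrightarrow> 2 * r dvd k - l" by (rule mod_eq_dvd_iff)
    finally show "y k = y l \<longleftrightarrow> 2 * r dvd k - l" .
  qed
  have ylow: "y k = x k" if "k = 0 \<or> 2 * d < k" "k \<le> 2 * r" for k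
  proof (cases "k = 2 * r")
    case True
    then show ?thesis using x2r by (simp add: y_def s_def)
  next
    case False
    then have "k mod (2 * r) = k" using that d by (intro mod_pos_pos_trivial) auto
    then show ?thesis using that by (auto simp: y_def s_def)
  qed
  have yhigh: "y k = x (2 * d + 1 - k)" if "1 \<le> k" "k \<le> 2 * d" for k
  proof -
    have "k mod (2 * r) = k" using that d by (intro mod_pos_pos_trivial) auto
    then show ?thesis using that by (auto simp: y_def s_def)
  qed
  have keep: "{x (2 * j), x (2 * j + 1)} \<in> M1" if "0 < j" "j < r" "j \<noteq> d" for j
  proof -
    have "x (2 * j) \<notin> {x 0, x 1, x (2 * d + 1), x (2 * d)}"
      using ne[of "2 * j" 0] ne[of "2 * j" 1] ne[of "2 * j" "2 * d + 1"] ne[of "2 * j" "2 * d"] that d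
      by auto
    then have "{x (2 * j), x (2 * j + 1)} \<notin> {{x 0, x 1}, {x (2 * d + 1), x (2 * d)}}"
      by auto
    then show ?thesis unfolding M1_def using eM[of j] by blast
  qed
  have "altcyc M1 M' r y"
    unfolding altcyc_def
  proof (intro conjI allI)
    fix k
    define i where "i = k mod r"
    have i: "0 \<le> i" "i < r" using d by (auto simp: i_def)
    have dv: "2 * r dvd 2 * k - 2 * i"
    proof -
      have "r dvd k - i" by (simp add: i_def)
      then have "2 * r dvd 2 * (k - i)" by (rule mult_dvd_mono[OF dvd_refl])
      then show ?thesis by (simp only: right_diff_distrib)
    qed
    have yk: "y (2 * k + c) = y (2 * i + c)" for c
      using dv cyc_iff[OF cy, of "2 * k + c" "2 * i + c"] by simp
    \<comment> \<open>Positions \<open>0\<close> and \<open>d\<close> carry the edges created by the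
      switch. Strictly between them, edge number \<open>i\<close> is the old edge number
      \<open>d - i\<close> traversed backwards; beyond \<open>d\<close> nothing changes.\<close>
    consider "i = 0" | "0 < i" "i < d" | "i = d" | "d < i" using i by linarith
    then have "{y (2 * i), y (2 * i + 1)} \<in> M1"
    proof cases
      case 1
      then show ?thesis using ylow[of 0] yhigh[of 1] d by (simp add: M1_def)
    next
      case 2
      then have "y (2 * i) = x (2 * (d - i) + 1)" "y (2 * i + 1) = x (2 * (d - i))"
        using yhigh[of "2 * i"] yhigh[of "2 * i + 1"] by (auto simp: algebra_simps)
      then show ?thesis using keep[of "d - i"] 2 d by (simp add: insert_commute)
    next
      case 3
      then show ?thesis using ylow[of "2 * d + 1"] yhigh[of "2 * d"] d by (simp add: M1_def insert_commute)
    next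
      case 4
      then show ?thesis using ylow[of "2 * i"] ylow[of "2 * i + 1"] keep[of i] i d by simp
    qed
    then show "{y (2 * k), y (2 * k + 1)} \<in> M1" using yk[of 0] yk[of 1] by simp
    have "{y (2 * i + 1), y (2 * i + 2)} \<in> M'"
    proof (cases "i < d")
      case True
      then have "y (2 * i + 1) = x (2 * (d - i - 1) + 2)" "y (2 * i + 2) = x (2 * (d - i - 1) + 1)"
        using yhigh[of "2 * i + 1"] yhigh[of "2 * i + 2"] i by (auto simp: algebra_simps)
      then show ?thesis using eM'[of "d - i - 1"] by (simp add: insert_commute)
    next
      case False
      then show ?thesis using ylow[of "2 * i + 1"] ylow[of "2 * i + 2"] eM'[of i] i by simp
    qed
    then show "{y (2 * k + 1), y (2 * k + 2)} \<in> M'" using yk[of 1] yk[of 2] by simp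
  qed (rule cy)
  moreover have yp: "y (2 * d + 1 - p) = x p" "y q = x q"
    using yhigh[of "2 * d + 1 - p"] ylow[of q] p q by auto
  \<comment> \<open>The only edges of the new cycle that join the reversed path to the rest are the
    two switch chords, and \<open>{x p, x q}\<close> differs from both.\<close>
  moreover have "{y (2 * d + 1 - p), y q} \<notin> cedges y"
  proof
    assume "{y (2 * d + 1 - p), y q} \<in> cedges y"
    then have "2 * r dvd q - (2 * d + 1 - p) - 1 \<or> 2 * r dvd q - (2 * d + 1 - p) + 1"
      using cedges_iff[OF cy] by blast
    then show False
    proof
      assume "2 * r dvd q - (2 * d + 1 - p) - 1"
      then have "q - (2 * d + 1 - p) - 1 = 0" by (rule small_dvd_int) (use p q in auto)
      then have "p = 1" "q = 2 * d + 1" using p q by auto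
      then show False using ch by simp
    next
      assume "2 * r dvd q - (2 * d + 1 - p) + 1"
      then have "2 * r dvd q - (2 * d + 1 - p) + 1 - 2 * r" by simp
      then have "q - (2 * d + 1 - p) + 1 - 2 * r = 0" by (rule small_dvd_int) (use p q in auto)
      then have "p = 2 * d" "q = 2 * r" using p q by auto
      then show False using ch x2r by (simp add: insert_commute)
    qed
  qed
  moreover have "odd (q - (2 * d + 1 - p))" using ev by simp
  \<comment> \<open>Two edges of \<open>M - M'\<close> leave and two edges enter. Equality is
    allowed, since the odd chord supplies the strict decrease afterwards.\<close>
  moreover have "card (M1 - M') \<le> card (M - M')"
  proof -
    let ?S = "{{x 0, x 1}, {x (2 * d + 1), x (2 * d)}}"
    have S: "?S \<subseteq> M - M'"
      using e01 e2d altcyc_new_edge[OF M' alt, of 0] altcyc_new_edge[OF M' alt, of d] d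
      by (auto simp: insert_commute)
    have finM: "finite (M - M')" using perfect_matching_card[OF M fin] by simp
    have "card (M1 - M') \<le> card ((M - M' - ?S) \<union> {{x (2 * d + 1), x 1}, {x 0, x (2 * d)}})"
      using finM by (intro card_mono) (auto simp: M1_def)
    also have "\<dots> \<le> card (M - M' - ?S) + card {{x (2 * d + 1), x 1}, {x 0, x (2 * d)}}"
      by (rule card_Un_le)
    also have "\<dots> \<le> card (M - M' - ?S) + 2" by (simp add: card_insert_if)
    also have "\<dots> = card (M - M')"
      using card_Diff_subset[OF _ S] card_mono[OF finM S] diff by simp
    finally show ?thesis .
  qed
  ultimately show ?thesis using that[of M1 y "2 * d + 1 - p" q] pm1 is1 ch by simp
qed

text \<open>Start at an end of an edge of \<open>M\<close> outside \<open>M'\<close> and apply the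
  partner maps of \<open>M\<close> and \<open>M'\<close> in turn. Both are involutions without fixed
  points, so the walk can be traced back, and its first repetition must be a return to the
  start.\<close>

lemma altcyc_exists:
  assumes M: "perfect_matching U E M" and M': "perfect_matching U E M'" and fin: "finite U"
    and "M \<noteq> M'"
  obtains x r where "2 \<le> r" "altcyc M M' (int r) x"
proof -
  define m where "m N u = (THE w. {u, w} \<in> N)" for N :: "'a set set" and u
  have m: "{u, m N u} \<in> N" "m N u \<in> U" "m N u \<noteq> u" "m N (m N u) = u"
    if N: "N \<in> {M, M'}" and u: "u \<in> U" for N u
  proof -
    have pm: "perfect_matching U E N" using N M M' by auto
    have eq: "m N u = w" if "{u, w} \<in> N" for u w
      unfolding m_def using that perfect_matching_partner_unique[OF pm] by blast
    obtain w where w: "{u, w} \<in> N" "w \<in> U" "w \<noteq> u" using perfect_matching_ex[OF pm u] .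
    then show "{u, m N u} \<in> N" "m N u \<in> U" "m N u \<noteq> u" "m N (m N u) = u"
      using eq[of u w] eq[of w u] by (auto simp: insert_commute)
  qed
  have "card M = card M'" "finite M" "finite M'"
    using perfect_matching_card M M' fin by (metis mult_cancel1 zero_neq_numeral)+
  then have "\<not> M \<subseteq> M'" using \<open>M \<noteq> M'\<close> card_subset_eq by blast
  then obtain e where e: "e \<in> M" "e \<notin> M'" by blast
  moreover have "e \<in> E" using e M by (auto simp: perfect_matching_def)
  then obtain u w where uw: "e = {u, w}" "u \<noteq> w" by (rule edgeE)
  ultimately have "{u, w} \<in> M" "{u, w} \<notin> M'" by auto
  have u: "u \<in> U" using e uw M by (auto simp: perfect_matching_def)
  have "m M u = w"
    using \<open>{u, w} \<in> M\<close> u m(1)[of M u] perfect_matching_partner_unique[OF M, of u "m M u" w] by simp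
  then have mm: "m M u \<noteq> m M' u"
    using m(1)[of M' u] u \<open>{u, w} \<notin> M'\<close> by auto
  define g where "g k = m (if even k then M else M')" for k :: nat
  define z where "z = rec_nat u g"
  have z0: "z 0 = u" and zS: "z (Suc k) = g k (z k)" for k by (simp_all add: z_def)
  have zU: "z k \<in> U" for k
    by (induction k) (auto simp: z0 zS u g_def m(2))
  have gg: "g k (z (Suc k)) = z k" and gfix: "g k (z k') \<noteq> z k'" for k k'
    using m(3,4)[OF _ zU] by (auto simp: zS g_def)
  have geq: "g k = g l" if "even k = even l" for k l
    using that by (simp add: g_def)
  have "\<not> inj z"
    using zU fin by (meson finite_subset image_subsetI infinite_UNIV_nat inj_on_finite finite_imageD)
  then obtain i j where "i < j" "z i = z j" by (metis injI linorder_neqE_nat)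
  then have ex: "\<exists>b. \<exists>a<b. z a = z b" by blast
  define b where "b = (LEAST b. \<exists>a<b. z a = z b)"
  obtain a where a: "a < b" "z a = z b"
    using LeastI_ex[OF ex] unfolding b_def by blast
  have dist: "z i \<noteq> z j" if "i < j" "j < b" for i j
    using not_less_Least[of j "\<lambda>b. \<exists>a<b. z a = z b"] that unfolding b_def by blast
  obtain b' where b': "b = Suc b'" using a by (cases b) auto
  have gb: "g b' (z a) = z b'" using gg[of b'] a b' by simp
  \<comment> \<open>If the closing edge belonged to the matching by which the walk left
    \<open>z a\<close>, then \<open>z b'\<close> would equal \<open>z (Suc a)\<close>, a repetition
    before time \<open>b\<close>.\<close>
  have up: "even a \<noteq> even b' \<or> b' = Suc a"
  proof (rule ccontr)
    assume "\<not> (even a \<noteq> even b' \<or> b' = Suc a)"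
    then have "z (Suc a) = z b'" "b' \<noteq> Suc a" using gb geq[of a b'] by (auto simp: zS)
    moreover have "b' \<noteq> a" using gb gfix by metis
    ultimately show False using dist[of "Suc a" b'] a b' by auto
  qed
  \<comment> \<open>For \<open>a > 0\<close> the other matching edge at \<open>z a\<close> is the
    one by which the walk arrived, so \<open>z b'\<close> would repeat \<open>z a'\<close>.\<close>
  have "a = 0"
  proof (rule ccontr)
    assume "a \<noteq> 0"
    then obtain a' where a': "a = Suc a'" by (cases a) auto
    have "even a = even b'"
    proof (rule ccontr)
      assume "even a \<noteq> even b'"
      then have "z a' = z b'" using gb gg[of a'] geq[of a' b'] a' by auto
      then show False using dist[of a' b'] a a' b' by auto
    qed
    then show False using up by auto
  qed
  have "odd b'" using up \<open>a = 0\<close> by auto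
  then have "even b" using b' by simp
  then obtain r where r: "b = 2 * r" by (rule evenE)
  have zb: "z (2 * r) = z 0" using a \<open>a = 0\<close> r by simp
  \<comment> \<open>A return after two steps would give \<open>u\<close> the same partner in both
    matchings.\<close>
  have "b \<noteq> 2"
  proof
    assume "b = 2"
    then have "m M' (m M u) = u"
      using a \<open>a = 0\<close> zS[of 0] zS[of 1] by (simp add: z0 g_def numeral_2_eq_2)
    then show False using mm m(4)[of M' "m M u"] m(2)[of M u] u by auto
  qed
  then have r2: "2 \<le> r" using r b' by auto
  define x where "x k = z (nat (k mod (2 * int r)))" for k
  have "altcyc M M' (int r) x"
    unfolding altcyc_def
  proof (intro conjI allI)
    show "cyc (2 * int r) x"
      unfolding cyc_def
    proof (intro allI)
      fix k l
      have lt: "nat (k mod (2 * int r)) < b" for k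
        using r2 pos_mod_bound[of "2 * int r" k] pos_mod_sign[of "2 * int r" k] by (simp add: r nat_less_iff)
      have "x k = x l \<longleftrightarrow> nat (k mod (2 * int r)) = nat (l mod (2 * int r))"
        unfolding x_def using dist lt by (metis linorder_neqE_nat)
      also have "\<dots> \<longleftrightarrow> k mod (2 * int r) = l mod (2 * int r)"
        using r2 by (simp add: nat_eq_iff)
      finally show "x k = x l \<longleftrightarrow> 2 * int r dvd k - l" by (simp add: mod_eq_dvd_iff)
    qed
    fix k
    define i where "i = nat (k mod int r)"
    have i: "k mod int r = int i" "i < r"
      using r2 by (auto simp: i_def nat_less_iff)
    obtain q where "k = int r * q + int i"
      using i(1) by (metis mult_div_mod_eq)
    then have q: "2 * k + c = (2 * int i + c) + (2 * int r) * q" for c by (simp add: algebra_simps)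
    have mod: "(2 * k + c) mod (2 * int r) = (2 * int i + c) mod (2 * int r)" for c
      unfolding q by (rule mod_mult_self2)
    have x0: "x (2 * k) = z (2 * i)"
      using mod[of 0] i by (simp add: x_def nat_mult_distrib)
    have x1: "x (2 * k + 1) = z (Suc (2 * i))"
    proof -
      have "(2 * int i + 1) mod (2 * int r) = int (Suc (2 * i))"
        using i by (subst mod_pos_pos_trivial) auto
      then show ?thesis unfolding x_def mod by (simp only: nat_int)
    qed
    have x2: "x (2 * k + 2) = z (Suc (Suc (2 * i)))"
    proof (cases "Suc i = r")
      case True
      then have "2 * int i + 2 = 2 * int r" by linarith
      then have "(2 * int i + 2) mod (2 * int r) = 0" by (simp only: mod_self)
      moreover have "Suc (Suc (2 * i)) = 2 * r" using True by simp
      ultimately show ?thesis unfolding x_def mod using zb by simp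
    next
      case False
      then have "(2 * int i + 2) mod (2 * int r) = int (Suc (Suc (2 * i)))"
        using i by (subst mod_pos_pos_trivial) auto
      then show ?thesis unfolding x_def mod by (simp only: nat_int)
    qed
    show "{x (2 * k), x (2 * k + 1)} \<in> M"
      unfolding x0 x1 zS[of "2 * i"] using m(1)[of M "z (2 * i)"] zU by (simp add: g_def)
    show "{x (2 * k + 1), x (2 * k + 2)} \<in> M'"
      unfolding x1 x2 zS[of "Suc (2 * i)"] using m(1)[of M' "z (Suc (2 * i))"] zU by (simp add: g_def)
  qed
  then show ?thesis using that r2 by blast
qed

text \<open>Passing to a vertex subset \<open>U\<close> costs nothing: an alternating cycle of two
  perfect matchings of \<open>U\<close> lies in \<open>U\<close>, and so do its chords.\<close>

lemma switchable_imp_reach: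
  assumes sw: "switchable E" and fin: "finite U"
  shows "perfect_matching U E M \<Longrightarrow> perfect_matching U E M' \<Longrightarrow> (sw_step U E)\<^sup>*\<^sup>* M M'"
proof (induction "card (M - M')" arbitrary: M M' rule: less_induct)
  case less
  note M = less.prems(1) and M' = less.prems(2)
  have IH: "(sw_step U E)\<^sup>*\<^sup>* N N'" if "card (N - N') < card (M - M')"
    "perfect_matching U E N" "perfect_matching U E N'" for N N'
    using less.hyps[OF that] .
  show ?case
  proof (cases "M = M'")
    case False
    obtain x r where r: "2 \<le> r" and alt: "altcyc M M' (int r) x"
      using altcyc_exists[OF M M' fin False] .
    have cx: "cyc (2 * int r) x" using alt by (simp add: altcyc_def)
    \<comment> \<open>Stated for arbitrary \<open>N\<close>, \<open>N'\<close> with a weak bound, so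
      that it serves both orders of \<open>M\<close> and \<open>M'\<close> and also the matching
      obtained after an even switch.\<close>
    have odd: "(sw_step U E)\<^sup>*\<^sup>* N N'"
      if h: "perfect_matching U E N" "perfect_matching U E N'" "card (N - N') \<le> card (M - M')"
        "altcyc N N' (int r) y" "{y a, y b} \<in> E" "{y a, y b} \<notin> cedges y" "odd (b - a)" for N N' y a b
    proof -
      obtain N'' where *: "perfect_matching U E N''" "card (N - N'') < card (N - N')"
        "card (N'' - N') < card (N - N')"
        using odd_chord_intermediate[OF h(1,2) fin h(4) _ h(5-7)] r by auto
      then have "(sw_step U E)\<^sup>*\<^sup>* N N''" "(sw_step U E)\<^sup>*\<^sup>* N'' N'"
        using IH h(1-3) by auto
      then show ?thesis by (rule rtranclp_trans)
    qed
    have diff: "card (M' - M) = card (M - M')" by (rule perfect_matching_diff_card[OF M' M fin])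
    show ?thesis
    proof (cases "r = 2")
      case True
      have e: "{x 0, x 1} \<in> M" "{x 2, x 3} \<in> M" "{x 1, x 2} \<in> M'" "{x 3, x 4} \<in> M'"
        using alt[unfolded altcyc_def, THEN conjunct2, rule_format, of 0]
          alt[unfolded altcyc_def, THEN conjunct2, rule_format, of 1] by auto
      have x4: "x 4 = x 0" using cyc_iff[OF cx, of 4 0] True by simp
      have d: "{x 0, x 1} \<noteq> {x 2, x 3}"
        using cyc_eqD[OF cx, of 0 2] cyc_eqD[OF cx, of 0 3] True by (auto simp: doubleton_eq_iff)
      have e': "{x 2, x 1} \<in> M'" "{x 0, x 3} \<in> M'" using e x4 by (simp_all add: insert_commute)
      then have eE: "{x 2, x 1} \<in> E" "{x 0, x 3} \<in> E" using M' by (auto simp: perfect_matching_def)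
      define M1 where "M1 = (M - {{x 0, x 1}, {x 2, x 3}}) \<union> {{x 2, x 1}, {x 0, x 3}}"
      have pm1: "perfect_matching U E M1"
        unfolding M1_def by (rule switch_perfect_matching[OF M e(1,2) d eE])
      have "is_switch E M M1" unfolding is_switch_def M1_def using e d eE by blast
      then have "sw_step U E M M1" using M pm1 by (simp add: sw_step_def)
      moreover have "(sw_step U E)\<^sup>*\<^sup>* M1 M'"
      proof (rule IH[OF _ pm1 M'], rule psubset_card_mono)
        show "finite (M - M')" using perfect_matching_card[OF M fin] by simp
        have "{x 0, x 1} \<in> M - M'" using altcyc_new_edge[OF M' alt, of 0] r e by simp
        moreover have "M1 - M' \<subseteq> M - M' - {{x 0, x 1}}" using e' by (auto simp: M1_def)
        ultimately show "M1 - M' \<subset> M - M'" by blast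
      qed
      ultimately show ?thesis by (rule converse_rtranclp_into_rtranclp)
    next
      case False
      then have r3: "3 \<le> r" using r by simp
      let ?C = "cedges x"
      have cx': "cyc (int (2 * r)) x" using cx by simp
      have "cycle_numbering ?C (2 * r) (\<lambda>m. x (0 + int m))"
        by (rule cycle_numbering_cedges[OF cx']) (use r in simp)
      moreover have "?C \<subseteq> E"
        using altcyc_cedges_subset[OF alt] M M' by (auto simp: perfect_matching_def)
      ultimately have "is_cycle E ?C (2 * r)" by (auto simp: is_cycle_def)
      then have "has_odd_chord E ?C r \<or> (\<exists>v i j e. even_switch E ?C r v i j \<and> crossing_chord E ?C r v i j e)"
        using sw r3 by (simp add: switchable_def)
      then show ?thesis
      proof
        assume "has_odd_chord E ?C r"
        then obtain v i j where v: "cycle_numbering ?C (2 * r) v" and ij: "1 \<le> i" "i < j" "j \<le> 2 * r"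
          "odd (j - i)" and ch: "chord E ?C {v i, v j}"
          unfolding has_odd_chord_def by blast
        obtain y where y: "cyc (int (2 * r)) y" "?C = cedges y"
          "\<And>m. 1 \<le> m \<Longrightarrow> m \<le> 2 * r \<Longrightarrow> v m = y (int m)"
          using cycle_numberingE[OF v] by metis
        have ch': "{y (int i), y (int j)} \<in> E" "{y (int i), y (int j)} \<notin> cedges y"
          using ch y ij by (auto simp: chord_def)
        have od: "odd (int j - int i)" using ij by (metis even_of_nat less_imp_le of_nat_diff)
        have "altcyc M M' (int r) y \<or> altcyc M' M (int r) y"
          by (rule altcyc_renumber[OF M M' alt]) (use y r in auto)
        then show ?thesis
          using odd[OF M M' _ _ ch' od] odd[OF M' M _ _ ch' od] diff reach_sym by auto
      next
        assume "\<exists>v i j e. even_switch E ?C r v i j \<and> crossing_chord E ?C r v i j e"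
        then obtain v i j k l where v: "cycle_numbering ?C (2 * r) v" and ij: "1 \<le> i" "i < j" "j \<le> r"
          and sw: "{v (2 * i - 1), v (2 * j - 1)} \<in> E" "{v (2 * i), v (2 * j)} \<in> E"
          and ch: "chord E ?C {v k, v l}"
            "{v k, v l} \<notin> {{v (2 * i - 1), v (2 * j - 1)}, {v (2 * i), v (2 * j)}}"
          and k: "k \<in> {2 * i..2 * j - 1}" and l: "l \<in> {2 * j..2 * r} \<union> {1..2 * i - 1}"
          unfolding even_switch_def crossing_chord_def by blast
        obtain y0 where y0: "cyc (int (2 * r)) y0" "?C = cedges y0"
          "\<And>m. 1 \<le> m \<Longrightarrow> m \<le> 2 * r \<Longrightarrow> v m = y0 (int m)"
          using cycle_numberingE[OF v] by metis
        \<comment> \<open>This shift puts \<open>v (2 * i - 1)\<close> at position 0, so the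
          switched cycle edges start at \<open>0\<close> and \<open>2 * d\<close>.\<close>
        define c where "c = 2 * int i - 1"
        define y where "y k = y0 (k + c)" for k
        define d where "d = int j - int i"
        have cy: "cyc (2 * int r) y" and ye: "cedges y = ?C"
          using cyc_shift[OF y0(1), of c] cedges_shift[of y0 c] y0(2) by (simp_all add: y_def[abs_def])
        have vy: "v m = y (int m - c)" if "1 \<le> m" "m \<le> 2 * r" for m
          using y0(3)[OF that] by (simp add: y_def)
        have v4: "v (2 * i - 1) = y 0" "v (2 * i) = y 1" "v (2 * j - 1) = y (2 * d)" "v (2 * j) = y (2 * d + 1)"
          using vy[of "2 * i - 1"] vy[of "2 * i"] vy[of "2 * j - 1"] vy[of "2 * j"] ij
          by (auto simp: c_def d_def of_nat_diff algebra_simps)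
        define p where "p = int k - c"
        have p: "v k = y p" "1 \<le> p" "p \<le> 2 * d"
          using vy[of k] k ij by (auto simp: p_def c_def d_def)
        \<comment> \<open>Indices before \<open>2 * i\<close> are moved up by one period;
          \<open>v (2 * i - 1)\<close> itself becomes \<open>q = 2 * r\<close>, not 0.\<close>
        obtain q where q: "v l = y q" "2 * d + 1 \<le> q" "q \<le> 2 * int r"
        proof (cases "2 * j \<le> l")
          case True
          show ?thesis by (rule that[of "int l - c"]) (use vy[of l] l True ij in \<open>auto simp: c_def d_def\<close>)
        next
          case False
          then have l': "1 \<le> l" "l \<le> 2 * i - 1" using l by auto
          have "y (int l - c) = y (int l - c + 2 * int r)" using cyc_iff[OF cy] by simp
          then show ?thesis using that[of "int l - c + 2 * int r"] vy[of l] l' ij by (auto simp: c_def d_def)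
        qed
        have d: "0 < d" "d < int r" using ij by (auto simp: d_def)
        have sw': "{y 0, y (2 * d)} \<in> E" "{y 1, y (2 * d + 1)} \<in> E" using sw v4 by simp_all
        have ch': "{y p, y q} \<in> E" "{y p, y q} \<notin> cedges y" "{y p, y q} \<noteq> {y 0, y (2 * d)}"
          "{y p, y q} \<noteq> {y 1, y (2 * d + 1)}"
          using ch p q v4 ye by (simp_all add: chord_def)
        have ev: "(sw_step U E)\<^sup>*\<^sup>* N N'"
          if N: "perfect_matching U E N" and N': "perfect_matching U E N'"
            and c: "card (N - N') \<le> card (M - M')" and a: "altcyc N N' (int r) y" for N N'
        \<comment> \<open>The crossing chord may itself be odd; then no switch is made.\<close>
        proof (cases "odd (q - p)")
          case True
          then show ?thesis using odd[OF N N' c a ch'(1,2)] by simp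
        next
          case False
          then have "even (q - p)" by simp
          then obtain N1 y1 a b where *: "perfect_matching U E N1" "is_switch E N N1"
            "altcyc N1 N' (int r) y1" "{y1 a, y1 b} \<in> E" "{y1 a, y1 b} \<notin> cedges y1" "odd (b - a)"
            "card (N1 - N') \<le> card (N - N')"
            using even_switch_reverse[OF N N' fin a d sw' ch' p(2,3) q(2,3)] by metis
          have "sw_step U E N N1" using N * by (simp add: sw_step_def)
          moreover have "(sw_step U E)\<^sup>*\<^sup>* N1 N'"
            using odd[OF *(1) N' _ *(3-6)] *(7) c by simp
          ultimately show ?thesis by (rule converse_rtranclp_into_rtranclp)
        qed
        have "altcyc M M' (int r) y \<or> altcyc M' M (int r) y"
          by (rule altcyc_renumber[OF M M' alt _ cy ye]) (use r in simp)
        then show ?thesis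
          using ev[OF M M'] ev[OF M' M] diff reach_sym by auto
      qed
    qed
  qed simp
qed

end

section \<open>Ergodic graphs are switchable\<close>

text \<open>Position of the partner in the matching formed by the edges
  \<open>{x (2 * k), x (2 * k + 1)}\<close>.\<close>

definition flip :: "int \<Rightarrow> int" where
  "flip k = (if even k then k + 1 else k - 1)"

lemma flip_flip [simp]: "flip (flip k) = k"
  by (simp add: flip_def)

lemma even_flip [simp]: "even (flip k) \<longleftrightarrow> odd k"
  by (simp add: flip_def)

text \<open>The period is even, so a vertex determines the parity of its positions; colour and
  partner are thus well defined on vertices.\<close>

lemma cyc_flip:
  assumes cx: "cyc (2 * r) x" and kl: "x k = x l"
  shows "even k = even l" "x (flip k) = x (flip l)"
proof -
  have dv: "2 * r dvd k - l" using kl cyc_iff[OF cx] by blast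
  then have "even (k - l)" using dvd_mult_left by blast
  then show e: "even k = even l" by simp
  have "flip k - flip l = k - l" using e by (simp add: flip_def)
  then show "x (flip k) = x (flip l)" using dv cyc_iff[OF cx] by metis
qed

text \<open>\<open>fl\<close> is the partner map of the initial matching and \<open>col\<close> the bipartition of the cycle: every
  edge outside the initial matching comes from an even switch, hence is monochromatic and occurs
  together with its mirror image. This is the invariant of all reachable matchings.\<close>

definition mirrored :: "('a \<Rightarrow> 'a) \<Rightarrow> ('a \<Rightarrow> bool) \<Rightarrow> 'a set set \<Rightarrow> bool" where
  "mirrored fl col N \<longleftrightarrow>
     (\<forall>u v. {u, v} \<in> N \<longrightarrow> v = fl u \<or> col u = col v \<and> {fl u, fl v} \<in> N)"

text \<open>The cut behind non-interference: \<open>S\<close> splits the edge \<open>{u, v}\<close>,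
  contains or misses each other partner pair as a whole, and is left only by edges within the four
  vertices of the switch.\<close>

definition separates :: "'a set set \<Rightarrow> ('a \<Rightarrow> 'a) \<Rightarrow> 'a set \<Rightarrow> 'a \<Rightarrow> 'a \<Rightarrow> 'a set \<Rightarrow> bool" where
  "separates E fl U u v S \<longleftrightarrow> (u \<in> S \<longleftrightarrow> v \<notin> S) \<and>
     (\<forall>w\<in>U. w \<notin> {u, v, fl u, fl v} \<longrightarrow> (w \<in> S \<longleftrightarrow> fl w \<in> S)) \<and>
     (\<forall>a\<in>U. \<forall>b\<in>U. {a, b} \<in> E \<longrightarrow> a \<in> S \<longrightarrow> b \<notin> S \<longrightarrow>
       a \<in> {u, v, fl u, fl v} \<and> b \<in> {u, v, fl u, fl v})"

text \<open>The indices \<open>c + p\<close> and \<open>c + q\<close> range over the two paths left by the even switch on the cycle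
  edges \<open>{x c, x (c + 1)}\<close> and \<open>{x (c + 2 * d), x (c + 2 * d + 1)}\<close>; the value \<open>q = 2 * r\<close> stands for
  \<open>x c\<close> itself.\<close>

definition uncrossed :: "'a set set \<Rightarrow> int \<Rightarrow> (int \<Rightarrow> 'a) \<Rightarrow> bool" where
  "uncrossed E r x \<longleftrightarrow> (\<forall>c d p q. 0 < d \<longrightarrow> d < r \<longrightarrow>
     {x c, x (c + 2 * d)} \<in> E \<longrightarrow> {x (c + 1), x (c + 2 * d + 1)} \<in> E \<longrightarrow>
     1 \<le> p \<longrightarrow> p \<le> 2 * d \<longrightarrow> 2 * d + 1 \<le> q \<longrightarrow> q \<le> 2 * r \<longrightarrow> {x (c + p), x (c + q)} \<in> E \<longrightarrow>
     {x (c + p), x (c + q)} \<in> cedges x \<union> {{x c, x (c + 2 * d)}, {x (c + 1), x (c + 2 * d + 1)}})"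

context finite_simple_graph
begin

text \<open>Only two kinds of switches are possible: two initial edges become a mirror pair of
  monochromatic edges, or a mirror pair turns back into initial edges. Reconnections by bichromatic
  edges contradict \<open>odd\<close>; a switch of a monochromatic edge with anything but its mirror
  image contradicts \<open>cut\<close>.\<close>

lemma mirrored_switch:
  assumes N: "perfect_matching U E N" and sw: "is_switch E N N'"
    and fl: "\<And>u. u \<in> U \<Longrightarrow> fl u \<in> U" "\<And>u. u \<in> U \<Longrightarrow> fl (fl u) = u"
      "\<And>u. u \<in> U \<Longrightarrow> col (fl u) \<longleftrightarrow> \<not> col u"
    and odd: "\<And>u v. u \<in> U \<Longrightarrow> v \<in> U \<Longrightarrow> u \<noteq> v \<Longrightarrow> col u = col v \<Longrightarrow>
      {v, fl u} \<in> E \<Longrightarrow> {u, fl v} \<in> E \<Longrightarrow> False"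
    and cut: "\<And>u v. u \<in> U \<Longrightarrow> v \<in> U \<Longrightarrow> {u, v} \<in> E \<Longrightarrow> {fl u, fl v} \<in> E \<Longrightarrow> col u = col v \<Longrightarrow>
      \<exists>S. separates E fl U u v S"
    and good: "mirrored fl col N"
  shows "mirrored fl col N'"
proof -
  have NE: "N \<subseteq> E" and NU: "\<And>u v. {u, v} \<in> N \<Longrightarrow> u \<in> U \<and> v \<in> U"
    using N by (auto simp: perfect_matching_def)
  \<comment> \<open>The ends \<open>a\<close>, \<open>b\<close> lie on one side of \<open>S\<close>
    and \<open>u\<close>, \<open>v\<close> on different sides, so \<open>{a, v}\<close> or
    \<open>{u, b}\<close> leaves \<open>S\<close> with an end outside the four switch
    vertices.\<close>
  have cross: False
    if uv: "{u, v} \<in> N" "v \<noteq> fl u" and ab: "{a, b} \<in> N" "{a, b} \<noteq> {u, v}" "{a, b} \<noteq> {fl u, fl v}"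
      and new: "{a, v} \<in> E" "{u, b} \<in> E" for u v a b
  proof -
    have uv': "col u = col v" "{fl u, fl v} \<in> N" using good uv by (auto simp: mirrored_def)
    let ?F = "{u, v, fl u, fl v}"
    have U: "u \<in> U" "v \<in> U" "a \<in> U" "b \<in> U" using NU uv ab by blast+
    have "{u, v} \<in> E" "{fl u, fl v} \<in> E" using uv uv' NE by blast+
    from cut[OF U(1,2) this uv'(1)] obtain S where S': "separates E fl U u v S" ..
    note S = S'[unfolded separates_def, THEN conjunct1]
      S'[unfolded separates_def, THEN conjunct2, THEN conjunct1]
      S'[unfolded separates_def, THEN conjunct2, THEN conjunct2]
    have nocross: False if "y \<in> U" "z \<in> U" "{y, z} \<in> E" "y \<in> S \<longleftrightarrow> z \<notin> S" "y \<notin> ?F \<or> z \<notin> ?F" for y z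
    proof (cases "y \<in> S")
      case True
      then show ?thesis using S(3)[rule_format, of y z] that by blast
    next
      case False
      then show ?thesis using S(3)[rule_format, of z y] that by (simp add: insert_commute)
    qed
    have F: "a \<notin> ?F" "b \<notin> ?F"
      using perfect_matching_eqD[OF N ab(1) uv(1)] perfect_matching_eqD[OF N ab(1) uv'(2)] ab(2,3)
      by auto
    have "a \<in> S \<longleftrightarrow> b \<in> S"
    proof (cases "b = fl a")
      case True
      then show ?thesis using S(2)[rule_format, OF U(3) F(1)] by simp
    next
      case False
      have "{a, b} \<in> E" using ab NE by blast
      then show ?thesis using nocross[OF U(3,4)] F by blast
    qed
    then have "(a \<in> S \<longleftrightarrow> v \<notin> S) \<or> (u \<in> S \<longleftrightarrow> b \<notin> S)" using S(1) by blast
    then show False using nocross[OF U(3,2) new(1)] nocross[OF U(1,4) new(2)] F by blast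
  qed
  obtain u v u' v' where e: "{u, v} \<in> N" "{u', v'} \<in> N" "{u, v} \<noteq> {u', v'}"
    and new: "{u', v} \<in> E" "{u, v'} \<in> E"
    and N': "N' = (N - {{u, v}, {u', v'}}) \<union> {{u', v}, {u, v'}}"
    using sw unfolding is_switch_def by blast
  have U: "u \<in> U" "v \<in> U" "u' \<in> U" "v' \<in> U" using NU e by blast+
  have d: "u \<noteq> v" "u' \<noteq> v'" using edge_neq NE e by blast+
  have d2: "u \<noteq> u'" "u \<noteq> v'" "v \<noteq> u'" "v \<noteq> v'"
    using perfect_matching_eqD[OF N e(1,2)] e(3) by auto
  define ok where "ok a b \<longleftrightarrow> b = fl a \<or> col a = col b \<and> {fl a, fl b} \<in> N'" for a b
  have ok_sym: "ok a b \<Longrightarrow> a \<in> U \<Longrightarrow> ok b a" for a b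
    using fl(2) unfolding ok_def by (metis insert_commute)
  \<comment> \<open>\<open>R\<close> turns out to be closed under \<open>fl\<close>, so an edge
    untouched by the switch has an untouched mirror image.\<close>
  define R where "R = {u, v, u', v'}"
  have main: "(ok u' v \<and> ok u v') \<and> (\<forall>w\<in>R. fl w \<in> R)"
  proof (cases "v = fl u \<and> v' = fl u'")
    case True
    then have fv: "fl v = u" "fl v' = u'" using fl(2) U by auto
    have "col u \<noteq> col u'"
      using odd[of u u'] U d2 new True by auto
    then have "col u' = col v" "col u = col v'" using True fl(3) U by auto
    then have "ok u' v" "ok u v'"
      using True fv by (auto simp: ok_def N' insert_commute)
    then show ?thesis using True fv by (simp add: R_def)
  next
    case False
    have "v = fl u' \<and> v' = fl u"
    proof (cases "v = fl u")
      case True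
      then have f: "v' \<noteq> fl u'" using False by simp
      then have c: "col u' = col v'" using good e(2) by (auto simp: mirrored_def)
      have "{u, v} = {fl u', fl v'}"
        using cross[OF e(2) f e(1)] e(3) new by blast
      then have "u = fl u' \<and> v = fl v' \<or> u = fl v' \<and> v = fl u'" by (auto simp: doubleton_eq_iff)
      then show ?thesis
      proof
        assume *: "u = fl u' \<and> v = fl v'"
        then show ?thesis using odd[of u' v'] U d c new by (simp add: insert_commute)
      next
        assume "u = fl v' \<and> v = fl u'"
        then show ?thesis using fl(2) U by metis
      qed
    next
      case f: False
      then have c: "col u = col v" using good e(1) by (auto simp: mirrored_def)
      have "{u', v'} = {fl u, fl v}"
        using cross[OF e(1) f e(2)] e(3) new by blast
      then have "u' = fl u \<and> v' = fl v \<or> u' = fl v \<and> v' = fl u" by (auto simp: doubleton_eq_iff)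
      then show ?thesis
      proof
        assume *: "u' = fl u \<and> v' = fl v"
        then show ?thesis using odd[of u v] U d c new by (simp add: insert_commute)
      next
        assume "u' = fl v \<and> v' = fl u"
        then show ?thesis using fl(2) U by metis
      qed
    qed
    then show ?thesis using fl(2) U by (auto simp: R_def ok_def)
  qed
  show ?thesis
    unfolding mirrored_def
  proof (intro allI impI)
    fix a b assume ab: "{a, b} \<in> N'"
    have "ok a b"
    proof (cases "{a, b} \<in> {{u', v}, {u, v'}}")
      case True
      then show ?thesis using main ok_sym U by (auto simp: doubleton_eq_iff)
    next
      case False
      then have abN: "{a, b} \<in> N" "{a, b} \<noteq> {u, v}" "{a, b} \<noteq> {u', v'}" using ab N' by auto
      have "a \<notin> R" using perfect_matching_eqD[OF N abN(1) e(1)] perfect_matching_eqD[OF N abN(1) e(2)] abN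
        by (auto simp: R_def)
      moreover have "fl (fl a) = a" using fl(2) NU abN by blast
      ultimately have "fl a \<notin> R" using main by metis
      then have "{fl a, fl b} \<noteq> {u, v}" "{fl a, fl b} \<noteq> {u', v'}" by (auto simp: R_def)
      then show ?thesis using good abN(1) by (auto simp: mirrored_def ok_def N')
    qed
    then show "b = fl a \<or> col a = col b \<and> {fl a, fl b} \<in> N'" by (simp add: ok_def)
  qed
qed

section \<open>Matchings, chords and even switches in terms of cycle positions\<close>

lemma perfect_matching_even_edges:
  assumes cx: "cyc (2 * r) x" and CE: "cedges x \<subseteq> E"
  shows "perfect_matching (range x) E (range (\<lambda>k. {x (2 * k), x (2 * k + 1)}))" (is "perfect_matching _ _ ?M")
  unfolding perfect_matching_def
proof (intro conjI)
  show "?M \<subseteq> E" using CE by (auto simp: cedges_def)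
  show "\<Union>?M = range x"
  proof
    show "range x \<subseteq> \<Union>?M"
    proof
      fix z assume "z \<in> range x"
      then obtain k where "z = x k" by auto
      moreover have "k = 2 * (k div 2) \<or> k = 2 * (k div 2) + 1" by presburger
      ultimately have "z \<in> {x (2 * (k div 2)), x (2 * (k div 2) + 1)}" by auto
      then show "z \<in> \<Union>?M" by blast
    qed
  qed auto
  have eq: "{x (2 * k), x (2 * k + 1)} = {x (2 * l), x (2 * l + 1)}"
    if "x i = x j" "i \<in> {2 * k, 2 * k + 1}" "j \<in> {2 * l, 2 * l + 1}" for i j k l
  proof -
    have dv: "2 * r dvd i - j" using that(1) cyc_iff[OF cx] by blast
    then have "even (i - j)" using dvd_mult_left by blast
    then have "i - j = 2 * k - 2 * l" using that(2,3) by auto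
    then have "2 * r dvd 2 * k - 2 * l" using dv by simp
    then have "x (2 * k) = x (2 * l)" "x (2 * k + 1) = x (2 * l + 1)" using cyc_iff[OF cx] by auto
    then show ?thesis by simp
  qed
  show "pairwise disjnt ?M"
  proof (rule pairwiseI)
    fix e f assume "e \<in> ?M" "f \<in> ?M" "e \<noteq> f"
    then obtain k l where kl: "e = {x (2 * k), x (2 * k + 1)}" "f = {x (2 * l), x (2 * l + 1)}" by blast
    show "disjnt e f"
    proof (rule ccontr)
      assume "\<not> disjnt e f"
      then obtain z where z: "z \<in> e" "z \<in> f" by (auto simp: disjnt_iff)
      obtain i where i: "z = x i" "i \<in> {2 * k, 2 * k + 1}" using z(1) kl(1) by blast
      obtain j where j: "z = x j" "j \<in> {2 * l, 2 * l + 1}" using z(2) kl(2) by blast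
      have "e = f" unfolding kl by (rule eq[OF _ i(2) j(2)]) (use i j in simp)
      then show False using \<open>e \<noteq> f\<close> by simp
    qed
  qed
qed

lemma odd_edge_in_cycle:
  assumes no: "\<not> has_odd_chord E (cedges x) r" and cx: "cyc (2 * int r) x" and r: "3 \<le> r"
    and kl: "{x k, x l} \<in> E" "odd (l - k)"
  shows "{x k, x l} \<in> cedges x"
proof (rule ccontr)
  assume ni: "{x k, x l} \<notin> cedges x"
  obtain l' where l': "k \<le> l'" "l' < k + 2 * int r" "x l = x l'"
    using cyc_rep[OF cx, of k l] r by auto
  have "2 * int r dvd l - l'" using l'(3) cyc_iff[OF cx] by blast
  then have "even (l - l')" using dvd_mult_left by blast
  then have od: "odd (l' - k)" using kl by simp
  define j where "j = nat (l' - k) + 1"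
  have j: "int j = l' - k + 1" using l' by (simp add: j_def)
  have "l' \<noteq> k" using od by auto
  then have j1: "1 < j" "j \<le> 2 * r" using j l' by auto
  have "cycle_numbering (cedges x) (2 * r) (\<lambda>m. x ((k - 1) + int m))"
    by (rule cycle_numbering_cedges) (use cx r in auto)
  moreover have "odd (j - 1)"
  proof -
    have "int (j - 1) = l' - k" using j j1 by simp
    then show ?thesis using od by (metis even_of_nat)
  qed
  moreover have "chord E (cedges x) {x ((k - 1) + int 1), x ((k - 1) + int j)}"
    using kl ni l' j by (auto simp: chord_def Union_cedges)
  ultimately have "has_odd_chord E (cedges x) r"
    unfolding has_odd_chord_def using j1 by (intro exI conjI) auto
  then show False using no by simp
qed

text \<open>Numbering the cycle from \<open>x c\<close> turns the given edges into an even switch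
  with \<open>i = 1\<close> and \<open>j = d + 1\<close>. Any \<open>c\<close>, even or odd, is
  allowed because a numbering may start anywhere.\<close>

lemma no_crossing_chord_imp_uncrossed:
  assumes no: "\<And>v i j e. \<not> (even_switch E (cedges x) r v i j \<and> crossing_chord E (cedges x) r v i j e)"
    and cx: "cyc (2 * int r) x" and r: "3 \<le> r"
  shows "uncrossed E (int r) x"
  unfolding uncrossed_def
proof (intro allI impI, rule ccontr)
  fix c d p q
  assume d: "0 < d" "d < int r"
    and sw: "{x c, x (c + 2 * d)} \<in> E" "{x (c + 1), x (c + 2 * d + 1)} \<in> E"
    and p: "1 \<le> p" "p \<le> 2 * d" and q: "2 * d + 1 \<le> q" "q \<le> 2 * int r"
    and e: "{x (c + p), x (c + q)} \<in> E"
    and ni: "{x (c + p), x (c + q)} \<notin> cedges x \<union> {{x c, x (c + 2 * d)}, {x (c + 1), x (c + 2 * d + 1)}}"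
  define v where "v m = x ((c - 1) + int m)" for m
  have cn: "cycle_numbering (cedges x) (2 * r) v"
    unfolding v_def[abs_def] by (rule cycle_numbering_cedges) (use cx r in auto)
  define j where "j = nat d + 1"
  have j: "int j = d + 1" using d by (simp add: j_def)
  have j1: "1 < j" "j \<le> r" using j d by auto
  have v4: "v (2 * 1 - 1) = x c" "v (2 * 1) = x (c + 1)" "v (2 * j - 1) = x (c + 2 * d)"
    "v (2 * j) = x (c + 2 * d + 1)"
    using j j1 by (auto simp: v_def of_nat_diff algebra_simps)
  define k where "k = nat p + 1"
  have k: "int k = p + 1" using p by (simp add: k_def)
  have vk: "v k = x (c + p)" "k \<in> {2 * 1..2 * j - 1}"
    using k p j by (auto simp: v_def)
  obtain l where l: "v l = x (c + q)" "l \<in> {2 * j..2 * r} \<union> {1..2 * 1 - 1}"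
  proof (cases "q = 2 * int r")
    case True
    have "x (c + 2 * int r) = x c" using cyc_iff[OF cx] by simp
    then show ?thesis using that[of 1] True by (simp add: v_def)
  next
    case False
    have l: "int (nat q + 1) = q + 1" using q d by simp
    show ?thesis
    proof (rule that[of "nat q + 1"])
      show "v (nat q + 1) = x (c + q)" using l by (simp add: v_def)
      have "2 * j \<le> nat q + 1" "nat q + 1 \<le> 2 * r" using l q j False by linarith+
      then show "nat q + 1 \<in> {2 * j..2 * r} \<union> {1..2 * 1 - 1}" by simp
    qed
  qed
  have "even_switch E (cedges x) r v 1 j"
    unfolding even_switch_def v4 using cn j1 sw by simp
  moreover have "crossing_chord E (cedges x) r v 1 j {v k, v l}"
    unfolding crossing_chord_def v4
  proof (intro conjI)
    show "chord E (cedges x) {v k, v l}" using vk l e ni by (auto simp: chord_def Union_cedges)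
    show "{v k, v l} \<notin> {{x c, x (c + 2 * d)}, {x (c + 1), x (c + 2 * d + 1)}}"
      using vk l ni by auto
    show "\<exists>k'\<in>{2 * 1..2 * j - 1}. \<exists>l'\<in>{2 * j..2 * r} \<union> {1..2 * 1 - 1}. {v k, v l} = {v k', v l'}"
      using vk(2) l(2) by blast
  qed
  ultimately show False using no by blast
qed

text \<open>Both edges must be cycle edges, which makes \<open>p - q\<close> and
  \<open>q - p\<close> congruent to the same value, 2 or -2, modulo \<open>2 * r\<close>. Adding
  gives \<open>2 * r dvd 4\<close>, impossible from length 6 on; in a 4-cycle the configuration does
  occur.\<close>

lemma no_crossed_pair:
  assumes cx: "cyc (2 * r) x" and r: "3 \<le> r"
    and odd: "\<And>k l. {x k, x l} \<in> E \<Longrightarrow> odd (l - k) \<Longrightarrow> {x k, x l} \<in> cedges x"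
    and pq: "x p \<noteq> x q" "even p = even q" and e: "{x q, x (flip p)} \<in> E" "{x p, x (flip q)} \<in> E"
  shows False
proof -
  have "odd (flip p - q)" "odd (flip q - p)" using pq(2) by auto
  then have "{x q, x (flip p)} \<in> cedges x" "{x p, x (flip q)} \<in> cedges x" using odd e by blast+
  then have 1: "2 * r dvd flip p - q - 1 \<or> 2 * r dvd flip p - q + 1"
    and 2: "2 * r dvd flip q - p - 1 \<or> 2 * r dvd flip q - p + 1"
    using cedges_iff[OF cx] by blast+
  have n: "\<not> 2 * r dvd p - q" "\<not> 2 * r dvd q - p"
    using pq(1) cyc_iff[OF cx] by metis+
  have "2 * r dvd 4"
  proof (cases "even p")
    case True
    then have "2 * r dvd p - q + 2" "2 * r dvd q - p + 2"
      using 1 2 n pq(2) by (auto simp: flip_def algebra_simps)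
    then have "2 * r dvd (p - q + 2) + (q - p + 2)" by (rule dvd_add)
    then show ?thesis by simp
  next
    case False
    then have "2 * r dvd p - q - 2" "2 * r dvd q - p - 2"
      using 1 2 n pq(2) by (auto simp: flip_def algebra_simps)
    then have "2 * r dvd - ((p - q - 2) + (q - p - 2))"
      unfolding dvd_minus_iff by (rule dvd_add)
    then show ?thesis by simp
  qed
  then show False using small_dvd_int[of "2 * r" 4] r by simp
qed

text \<open>\<open>S\<close> is one of the two paths of the switch. Cycle edges leave it only at its
  ends, which belong to \<open>F\<close>, and any other leaving edge is a switch chord or a crossing
  chord. As \<open>c\<close> is even, the only partner pairs cut are the two switched edges.\<close>

lemma switch_cut_even:
  assumes cx: "cyc (2 * r) x"
    and cross: "uncrossed E r x"
    and d: "0 < d" "d < r" and c: "even c"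
    and sw: "{x c, x (c + 2 * d)} \<in> E" "{x (c + 1), x (c + 2 * d + 1)} \<in> E"
  defines "F \<equiv> {x c, x (c + 2 * d), x (c + 1), x (c + 2 * d + 1)}"
    and "S \<equiv> x ` {c + 1..c + 2 * d}"
  shows "x c \<notin> S \<and> x (c + 2 * d) \<in> S \<and> x (c + 1) \<in> S \<and> x (c + 2 * d + 1) \<notin> S"
    "x w \<notin> F \<Longrightarrow> x w \<in> S \<longleftrightarrow> x (flip w) \<in> S"
    "\<lbrakk>b \<in> range x; {a, b} \<in> E; a \<in> S; b \<notin> S\<rbrakk> \<Longrightarrow> a \<in> F \<and> b \<in> F"
proof -
  have inS: "x l \<in> S \<longleftrightarrow> c + 1 \<le> l \<and> l \<le> c + 2 * d" if "c \<le> l" "l < c + 2 * r" for l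
  proof
    assume "x l \<in> S"
    then obtain l' where l': "x l = x l'" "c + 1 \<le> l'" "l' \<le> c + 2 * d" by (auto simp: S_def)
    have "\<bar>l - l'\<bar> < 2 * r" using that l' d by linarith
    then have "l = l'" using cyc_eqD[OF cx l'(1)] by simp
    then show "c + 1 \<le> l \<and> l \<le> c + 2 * d" using l' by simp
  qed (auto simp: S_def)
  show "x c \<notin> S \<and> x (c + 2 * d) \<in> S \<and> x (c + 1) \<in> S \<and> x (c + 2 * d + 1) \<notin> S"
    using inS[of c] inS[of "c + 2 * d"] inS[of "c + 1"] inS[of "c + 2 * d + 1"] d by simp
  show "x w \<in> S \<longleftrightarrow> x (flip w) \<in> S" if "x w \<notin> F"
  proof -
    obtain l where l: "c \<le> l" "l < c + 2 * r" "x w = x l"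
      using cyc_rep[OF cx, of c w] d by auto
    have wl: "x (flip w) = x (flip l)" using cyc_flip[OF cx l(3)] by simp
    have nl: "l \<noteq> c" "l \<noteq> c + 1" "l \<noteq> c + 2 * d" "l \<noteq> c + 2 * d + 1"
      using that l(3) by (auto simp: F_def)
    have f: "c \<le> flip l" "flip l < c + 2 * r"
      using l(1,2) c unfolding flip_def by presburger+
    have "(c + 1 \<le> l \<and> l \<le> c + 2 * d) \<longleftrightarrow> (c + 1 \<le> flip l \<and> flip l \<le> c + 2 * d)"
      using nl c unfolding flip_def by presburger
    then show ?thesis using inS[OF l(1,2)] inS[OF f] l(3) wl by simp
  qed
  show "a \<in> F \<and> b \<in> F" if "b \<in> range x" and ab: "{a, b} \<in> E" and a: "a \<in> S" and b: "b \<notin> S"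
  proof -
    have x2r: "x (c + 2 * r) = x c" using cyc_iff[OF cx] by simp
    obtain p where p: "a = x (c + p)" "1 \<le> p" "p \<le> 2 * d"
    proof -
      obtain k where "a = x k" "c + 1 \<le> k" "k \<le> c + 2 * d" using a by (auto simp: S_def)
      then show ?thesis using that[of "k - c"] by simp
    qed
    obtain q where q: "b = x (c + q)" "2 * d + 1 \<le> q" "q \<le> 2 * r"
    proof -
      obtain k where "b = x k" using \<open>b \<in> range x\<close> by auto
      \<comment> \<open>The window starts at \<open>c + 1\<close>, so that \<open>x c\<close> is
        represented by \<open>c + 2 * r\<close>, that is by \<open>q = 2 * r\<close>.\<close>
      moreover obtain l where l: "c + 1 \<le> l" "l < c + 1 + 2 * r" "x k = x l"
        using cyc_rep[OF cx, of "c + 1" k] d by auto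
      ultimately have "\<not> (c + 1 \<le> l \<and> l \<le> c + 2 * d)" using b by (auto simp: S_def)
      then show ?thesis using that[of "l - c"] l \<open>b = x k\<close> by simp
    qed
    have "{a, b} \<in> cedges x \<union> {{x c, x (c + 2 * d)}, {x (c + 1), x (c + 2 * d + 1)}}"
      unfolding p(1) q(1) by (rule cross[unfolded uncrossed_def, rule_format]) (use d sw p q ab in auto)
    then show ?thesis
    proof
      assume "{a, b} \<in> cedges x"
      then have "2 * r dvd (c + q) - (c + p) - 1 \<or> 2 * r dvd (c + q) - (c + p) + 1"
        unfolding p(1) q(1) using cedges_iff[OF cx] by blast
      then show ?thesis
      proof
        assume "2 * r dvd (c + q) - (c + p) - 1"
        then have "(c + q) - (c + p) - 1 = 0" by (rule small_dvd_int) (use p q in linarith)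
        then have "p = 2 * d" "q = 2 * d + 1" using p q by auto
        then show ?thesis using p q by (simp add: F_def add.assoc)
      next
        assume "2 * r dvd (c + q) - (c + p) + 1"
        then have "2 * r dvd (c + q) - (c + p) + 1 - 2 * r" by (simp only: dvd_diff dvd_refl)
        then have "(c + q) - (c + p) + 1 - 2 * r = 0" by (rule small_dvd_int) (use p q in linarith)
        then have "p = 1" "q = 2 * r" using p q by auto
        then show ?thesis using p q x2r by (simp add: F_def)
      qed
    qed (auto simp: F_def doubleton_eq_iff)
  qed
qed

text \<open>Replacing \<open>p\<close> and \<open>q\<close> by their flips leaves the four vertices
  unchanged, so both positions may be taken even. Then \<open>x q\<close> is found at an even
  distance \<open>2 * d\<close> after \<open>x p\<close>, and \<open>d > 0\<close> as there are no
  loops.\<close>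

lemma switch_cut:
  assumes cx: "cyc (2 * r) x" and r: "0 < r"
    and cross: "uncrossed E r x"
    and fl: "\<And>k. fl (x k) = x (flip k)"
    and pq: "{x p, x q} \<in> E" "{x (flip p), x (flip q)} \<in> E" "even p = even q"
  shows "\<exists>S. separates E fl (range x) (x p) (x q) S"
proof -
  obtain c k where ck: "even c" "even k" "{x c, x k} \<in> E" "{x (flip c), x (flip k)} \<in> E"
    "p = c \<and> q = k \<or> p = flip c \<and> q = flip k"
  proof (cases "even p")
    case True
    then show ?thesis using that[of p q] pq by auto
  next
    case False
    then show ?thesis using that[of "flip p" "flip q"] pq by auto
  qed
  have F: "{x p, x q, x (flip p), x (flip q)} = {x c, x k, x (flip c), x (flip k)}"
    using ck(5) by auto
  obtain l where l: "c \<le> l" "l < c + 2 * r" "x k = x l"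
    using cyc_rep[OF cx, of c k] r by auto
  have lf: "even l" "x (flip k) = x (flip l)" using cyc_flip[OF cx l(3)] ck(2) by simp_all
  define d where "d = (l - c) div 2"
  have ld: "l = c + 2 * d" using ck(1) lf(1) by (simp add: d_def)
  have "l \<noteq> c" using edge_neq[OF ck(3)] l(3) by auto
  then have d: "0 < d" "d < r" using l ld by auto
  have k: "x k = x (c + 2 * d)" "x (flip k) = x (c + 2 * d + 1)" "flip c = c + 1"
    using l lf ld ck(1) by (simp_all add: flip_def)
  have sw: "{x c, x (c + 2 * d)} \<in> E" "{x (c + 1), x (c + 2 * d + 1)} \<in> E" using ck k by simp_all
  note cut = switch_cut_even[OF cx cross d ck(1) sw]
  let ?S = "x ` {c + 1..c + 2 * d}"
  show ?thesis
    unfolding separates_def fl F k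
  proof (intro exI[of _ ?S] conjI ballI impI)
    show "x p \<in> ?S \<longleftrightarrow> x q \<notin> ?S"
      using cut(1) ck(5) k by metis
  next
    fix w assume "w \<in> range x" and w: "w \<notin> {x c, x (c + 2 * d), x (c + 1), x (c + 2 * d + 1)}"
    then obtain j where j: "w = x j" by blast
    show "w \<in> ?S \<longleftrightarrow> fl w \<in> ?S" using cut(2)[of j] w unfolding j fl .
  next
    fix a b assume "b \<in> range x" "{a, b} \<in> E" "a \<in> ?S" "b \<notin> ?S"
    then have "a \<in> {x c, x (c + 2 * d), x (c + 1), x (c + 2 * d + 1)} \<and>
        b \<in> {x c, x (c + 2 * d), x (c + 1), x (c + 2 * d + 1)}"
      by (rule cut(3))
    then show "a \<in> {x c, x (c + 2 * d), x (c + 1), x (c + 2 * d + 1)}"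
      "b \<in> {x c, x (c + 2 * d), x (c + 1), x (c + 2 * d + 1)}" by blast+
  qed
qed

lemma ergodic_imp_switchable:
  assumes erg: "hereditarily_ergodic V E"
  shows "switchable E"
  unfolding switchable_def
proof (intro allI impI)
  fix C r
  assume "6 \<le> 2 * r \<and> is_cycle E C (2 * r)"
  then obtain v where r: "3 \<le> r" and CE: "C \<subseteq> E" and v: "cycle_numbering C (2 * r) v"
    by (auto simp: is_cycle_def)
  obtain x where "cyc (int (2 * r)) x" and C: "C = cedges x"
    using cycle_numberingE[OF v] by metis
  then have cx: "cyc (2 * int r) x" by simp
  show "has_odd_chord E C r \<or> (\<exists>v i j e. even_switch E C r v i j \<and> crossing_chord E C r v i j e)"
  proof (rule ccontr)
    assume n: "\<not> ?thesis"
    have odd: "{x k, x l} \<in> cedges x" if "{x k, x l} \<in> E" "odd (l - k)" for k l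
      using odd_edge_in_cycle[OF _ cx r that] n C by blast
    have cross: "uncrossed E (int r) x"
      using no_crossing_chord_imp_uncrossed[OF _ cx r] n C by blast
    define U where "U = range x"
    define M where "M = range (\<lambda>k. {x (2 * k), x (2 * k + 1)})"
    define y where "y k = x (k + 1)" for k
    define M' where "M' = range (\<lambda>k. {y (2 * k), y (2 * k + 1)})"
    have M: "perfect_matching U E M"
      unfolding U_def M_def using perfect_matching_even_edges[OF cx] CE C by simp
    have cy: "cyc (2 * int r) y" "cedges y = cedges x"
      using cyc_shift[OF cx, of 1] cedges_shift[of x 1] by (simp_all add: y_def[abs_def])
    then have "range y = U" using Union_cedges[of x] Union_cedges[of y] U_def by simp
    then have M': "perfect_matching U E M'"
      unfolding M'_def using perfect_matching_even_edges[OF cy(1)] cy(2) CE C by simp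
    have "U \<subseteq> V"
      using CE C edge_wf Union_cedges[of x] U_def by blast
    then have reach: "(sw_step U E)\<^sup>*\<^sup>* M M'"
      using erg M M' ergodic_induced_iff by (auto simp: hereditarily_ergodic_def)
    \<comment> \<open>Any position of \<open>u\<close> will do: by \<open>cyc_flip\<close> neither
      the colour nor the partner depends on the choice.\<close>
    define ix where "ix u = (SOME k. u = x k)" for u
    have ix: "x (ix u) = u" if "u \<in> U" for u
      using that someI[of "\<lambda>k. u = x k"] unfolding U_def ix_def by auto
    define fl where "fl u = x (flip (ix u))" for u
    define col where "col u \<longleftrightarrow> even (ix u)" for u
    have fx: "fl (x k) = x (flip k)" "col (x k) = even k" for k
      using cyc_flip[OF cx ix[of "x k"]] by (auto simp: fl_def col_def U_def)
    have flU: "fl u \<in> U" "fl (fl u) = u" "col (fl u) \<longleftrightarrow> \<not> col u" if "u \<in> U" for u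
      using that fx by (auto simp: U_def)
    have K: False if "u \<in> U" "w \<in> U" "u \<noteq> w" "col u = col w" "{w, fl u} \<in> E" "{u, fl w} \<in> E" for u w
    proof -
      obtain p q where pq: "u = x p" "w = x q" using \<open>u \<in> U\<close> \<open>w \<in> U\<close> by (auto simp: U_def)
      show False
        by (rule no_crossed_pair[OF cx _ odd, of p q]) (use that r pq fx in auto)
    qed
    have cut: "\<exists>S. separates E fl U u w S"
      if "u \<in> U" "w \<in> U" "{u, w} \<in> E" "{fl u, fl w} \<in> E" "col u = col w" for u w
    proof -
      obtain p q where pq: "u = x p" "w = x q" using \<open>u \<in> U\<close> \<open>w \<in> U\<close> by (auto simp: U_def)
      show ?thesis
        unfolding pq U_def by (rule switch_cut[OF cx _ cross fx(1)]) (use that pq fx r in auto)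
    qed
    have "mirrored fl col N" if "(sw_step U E)\<^sup>*\<^sup>* M N" for N
      using that
    proof (induction rule: rtranclp_induct)
      case base
      show ?case
        unfolding mirrored_def
      proof (intro allI impI disjI1)
        fix u w assume "{u, w} \<in> M"
        then obtain k where "{u, w} = {x (2 * k), x (2 * k + 1)}" by (auto simp: M_def)
        then show "w = fl u" using fx by (auto simp: doubleton_eq_iff flip_def)
      qed
    next
      case (step N N')
      then have N: "perfect_matching U E N" "is_switch E N N'"
        using is_switch_sym by (auto simp: sw_step_def)
      show ?case
        by (rule mirrored_switch[OF N flU K cut step.IH])
    qed
    then have "mirrored fl col M'" using reach .
    \<comment> \<open>Positions 1 and 2 have different colours, and the partner of
      \<open>x 1\<close> is \<open>x 0\<close>; the invariant would force
      \<open>x 2 = x 0\<close>.\<close>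
    moreover have "{x 1, x 2} \<in> M'"
      unfolding M'_def by (rule range_eqI[of _ _ 0]) (simp add: y_def)
    ultimately have "x 2 = fl (x 1) \<or> col (x 1) = col (x 2)" by (auto simp: mirrored_def)
    then have "x 2 = x 0" using fx by (simp add: flip_def)
    then show False using cyc_eqD[OF cx, of 2 0] r by auto
  qed
qed

lemma switchable_imp_ergodic:
  assumes "switchable E"
  shows "hereditarily_ergodic V E"
  unfolding hereditarily_ergodic_def ergodic_induced_iff
proof (intro allI impI)
  fix U M M' assume "U \<subseteq> V" "perfect_matching U E M" "perfect_matching U E M'"
  then show "(sw_step U E)\<^sup>*\<^sup>* M M'"
    using switchable_imp_reach[OF assms finite_subset[OF _ finite_verts]] by blast
qed

end

theorem theorem1:
  fixes V :: "'a set" and E :: "'a set set"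
  assumes "finite_simple_graph V E"
  shows "hereditarily_ergodic V E \<longleftrightarrow> switchable E"
  using assms finite_simple_graph.ergodic_imp_switchable finite_simple_graph.switchable_imp_ergodic
  by blast

end
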